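(* Let $\varepsilon_1,\varepsilon_2>0$ and $\beta,\delta\in(0,1)$. Suppose the SliceQuantiles mechanism is run with $$w=\frac{3\log(m)\log(2m/\delta)}{\varepsilon_1},$$ with SingleQuantile set to be the exponential mechanism, with $\gamma=0$ and $\ell=2\left\lceil\frac{2\log(2bm/\beta)}{\varepsilon_2}\right\rceil+1$. Then the algorithm satisfies $(\varepsilon,\delta)$-differential privacy (under add/remove adjacency) with $\varepsilon=\varepsilon_1+2\varepsilon_2$, and with probability at least $1-\beta-\delta$ it achieves the error bound $$\mathrm{Err}_X(Q,Z)\le O\left(\frac{\log(b)}{\varepsilon}+\frac{\log(m)\log(m/\beta)}{\varepsilon}\right)$$ for any input quantiles with gap $$\frac{6\log(m)\log(2m/\delta)}{\varepsilon_1 n}+\frac{4\log(2bm/\beta)}{\varepsilon_2 n}.$$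
   Context: $X$ is a dataset of $n$ points in $[0,b]$ with minimum separation $1$ (any two points are at distance at least $1$); $x_{(i)}$ is the $i$-th smallest element of $X$. $Q$ is a set of quantiles $0\le q_1<\dots<q_m\le1$, with ranks $r_i=\lfloor q_in\rfloor$; the gap of the quantiles being a given quantity means $|q_i-q_{i-1}|$ is at least that quantity for all $i$. $Z=(z_1,\dots,z_m)$ is the output, $\mathrm{rank}_X(z)$ is the rank of $z$ in $X$ (the number of data points below $z$), and $\mathrm{Err}_X(Q,Z)=\max_{i}|\mathrm{rank}_X(z_i)-\lfloor q_in\rfloor|$. $X,X'$ are add/remove adjacent if $X'=X\cup\{x\}$ or $X=X'\cup\{x\}$ for a point $x$. A mechanism $\mathcal M$ is $(\varepsilon,\delta)$-differentially private if $\Pr[\mathcal M(X)\in S]\le e^{\varepsilon}\Pr[\mathcal M(X')\in S]+\delta$ for all adjacent $X,X'$ and all output sets $S$. The base of the logarithm is not specified in the source. $\mathrm{Good}_{m,n,\Delta}=\{\tilde{\mathbf r}\in\mathbb{Z}^m: \tilde r_1-\Delta\ge1,\ \tilde r_i-\tilde r_{i-1}>2\Delta\ (2\le i\le m),\ \tilde r_m\le n-\Delta\}$. $\mathrm{CC}_{\varepsilon}:\mathbb{Z}^m\to\mathbb{Z}^m$ is a randomized algorithm such that (1) $\Pr[\mathrm{CC}_\varepsilon(\mathbf r)=\tilde{\mathbf r}]\le e^{\varepsilon}\Pr[\mathrm{CC}_\varepsilon(\mathbf r)=\tilde{\mathbf r}+\mathbf e]$ for all $\mathbf r,\tilde{\mathbf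 r}\in\mathbb{Z}^m$ and every $\mathbf e$ for which there are $0\le t\le m$, $c\in\{-1,1\}$ with $e_i=0$ for $i\le t$ and $e_i=c$ for $i>t$; and (2) $\Pr[\|\mathbf r-\mathrm{CC}_\varepsilon(\mathbf r)\|_\infty\ge 3\log(m)\log(2m/\beta)/\varepsilon]\le\beta$ for all $\beta>0$. Exponential mechanism (for the median, privacy parameter $\varepsilon_2$, utility the negative rank error): on a dataset $S$, sample $z\in[0,b]$ with density proportional to $\exp\left(-\frac{\varepsilon_2}{2}\left|\mathrm{rank}_S(z)-\lfloor |S|/2\rfloor\right|\right)$. SliceQuantiles on input $X$, $r_1,\dots,r_m$, with parameters $(w,\varepsilon_1)$, $(\ell,\varepsilon_2)$, $\gamma$: set $h=\lceil(\ell-1)/2\rceil$; the ranks are required to satisfy $(r_1,\dots,r_m)\in\mathrm{Good}_{m,n,w+h}$. Sample $\tilde{\mathbf r}\leftarrow\mathrm{CC}_{\varepsilon_1}(r_1,\dots,r_m)$; flip a coin with heads probability $\gamma$; if the coin is heads or $\tilde{\mathbf r}\notin\mathrm{Good}_{m,n,h}$, sample $z_1,\dots,z_m$ i.i.d. (uniformly) from $[0,b]$ and return them; otherwise, for each $i$, let $S_i=[x_{(\tilde r_i-h)},\dots,x_{(\tilde r_i+h)}]$ and $z_i\leftarrow\mathrm{SingleQuantile}(S_i)$ (run with privacy parameter $\varepsilon_2$), and return $z_1,\dots,z_m$.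
   Formalization: Logs are natural; ranks are a fixed input in Good_{m,n,w+h}. Privacy also needs rank spacing at least 2(⌈w⌉+h), as it fails otherwise; the O-constant depends on K, where ε₁ ≤ Kε₂, ε₂ ≤ Kε₁, ε ≤ K, since no absolute constant works. *)

theory Defs
  imports "HOL-Probability.Probability"
begin

text \<open>
  Vectors indexed by \<open>1, \<dots>, m\<close> are extensional functions on \<open>{1..m}\<close>. All logarithms
  are natural: with slice half-width \<open>\<lceil>2 log (2bm/\<beta>) / \<epsilon>\<^sub>2\<rceil>\<close>, the tail of the exponential
  mechanism, \<open>exp (- \<epsilon>\<^sub>2 h / 2)\<close>, is then at most \<open>\<beta> / (2bm)\<close>.
\<close>

definition int_vecs :: "nat \<Rightarrow> (nat \<Rightarrow> int) set" where
  "int_vecs m = {1..m} \<rightarrow>\<^sub>E UNIV"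

definition linf_dist :: "nat \<Rightarrow> (nat \<Rightarrow> int) \<Rightarrow> (nat \<Rightarrow> int) \<Rightarrow> int" where
  "linf_dist m r s = Max ((\<lambda>i. \<bar>r i - s i\<bar>) ` {1..m})"

definition dataset :: "real \<Rightarrow> real set \<Rightarrow> bool" where
  "dataset b X \<longleftrightarrow> finite X \<and> X \<subseteq> {0..b} \<and> (\<forall>x\<in>X. \<forall>y\<in>X. x \<noteq> y \<longrightarrow> 1 \<le> \<bar>x - y\<bar>)"

definition add_remove_adjacent :: "real set \<Rightarrow> real set \<Rightarrow> bool" where
  "add_remove_adjacent X X' \<longleftrightarrow> (\<exists>x. X' = X \<union> {x} \<or> X = X' \<union> {x})"

text \<open>The \<open>i\<close>-th smallest element, counting from \<open>i = 1\<close>; junk unless \<open>1 \<le> i \<le> card X\<close>.\<close>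

definition order_stat :: "real set \<Rightarrow> int \<Rightarrow> real" where
  "order_stat X i = sorted_list_of_set X ! nat (i - 1)"

definition rank_in :: "real set \<Rightarrow> real \<Rightarrow> int" where
  "rank_in X z = int (card {x \<in> X. x < z})"

definition quantiles :: "nat \<Rightarrow> (nat \<Rightarrow> real) \<Rightarrow> bool" where
  "quantiles m q \<longleftrightarrow> q ` {1..m} \<subseteq> {0..1} \<and> strict_mono_on {1..m} q"

definition quantile_gap_ge :: "nat \<Rightarrow> (nat \<Rightarrow> real) \<Rightarrow> real \<Rightarrow> bool" where
  "quantile_gap_ge m q g \<longleftrightarrow> (\<forall>i\<in>{2..m}. g \<le> \<bar>q i - q (i - 1)\<bar>)"

definition quantile_ranks :: "nat \<Rightarrow> (nat \<Rightarrow> real) \<Rightarrow> nat \<Rightarrow> nat \<Rightarrow> int" where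
  "quantile_ranks m q n = (\<lambda>i\<in>{1..m}. \<lfloor>q i * real n\<rfloor>)"

definition Err :: "nat \<Rightarrow> real set \<Rightarrow> (nat \<Rightarrow> real) \<Rightarrow> (nat \<Rightarrow> real) \<Rightarrow> int" where
  "Err m X q z = Max ((\<lambda>i. \<bar>rank_in X (z i) - \<lfloor>q i * real (card X)\<rfloor>\<bar>) ` {1..m})"

definition Good :: "nat \<Rightarrow> nat \<Rightarrow> real \<Rightarrow> (nat \<Rightarrow> int) set" where
  "Good m n \<Delta> = {r \<in> int_vecs m.
     1 \<le> real_of_int (r 1) - \<Delta> \<and>
     (\<forall>i\<in>{2..m}. real_of_int (r i - r (i - 1)) > 2 * \<Delta>) \<and>
     real_of_int (r m) \<le> real n - \<Delta>}"

text \<open>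
  \<open>D\<close> is the set of inputs on which the mechanism is defined. Output sets range over the
  measurable sets of the output space.
\<close>

definition differentially_private ::
    "'a set \<Rightarrow> ('a \<Rightarrow> 'a \<Rightarrow> bool) \<Rightarrow> ('a \<Rightarrow> 'b measure) \<Rightarrow> real \<Rightarrow> real \<Rightarrow> bool" where
  "differentially_private D adj M \<epsilon> \<delta> \<longleftrightarrow>
     (\<forall>X\<in>D. \<forall>X'\<in>D. adj X X' \<longrightarrow>
        (\<forall>S\<in>sets (M X). measure (M X) S \<le> exp \<epsilon> * measure (M X') S + \<delta>))"

definition suffix_shift :: "nat \<Rightarrow> nat \<Rightarrow> int \<Rightarrow> (nat \<Rightarrow> int) \<Rightarrow> nat \<Rightarrow> int" where
  "suffix_shift m t c r = (\<lambda>i\<in>{1..m}. r i + (if i \<le> t then 0 else c))"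

text \<open>
  The requirements on \<open>CC\<close> for privacy parameter \<open>\<epsilon>\<close>. They are unsatisfiable for \<open>m = 1\<close>:
  the accuracy threshold is then \<open>0\<close>.
\<close>

definition is_CC :: "nat \<Rightarrow> real \<Rightarrow> ((nat \<Rightarrow> int) \<Rightarrow> (nat \<Rightarrow> int) pmf) \<Rightarrow> bool" where
  "is_CC m \<epsilon> CC \<longleftrightarrow>
     (\<forall>r\<in>int_vecs m. set_pmf (CC r) \<subseteq> int_vecs m) \<and>
     (\<forall>r\<in>int_vecs m. \<forall>s\<in>int_vecs m. \<forall>t\<in>{0..m}. \<forall>c\<in>{-1, 1}.
        pmf (CC r) s \<le> exp \<epsilon> * pmf (CC r) (suffix_shift m t c s)) \<and>
     (\<forall>r\<in>int_vecs m. \<forall>\<beta>>0.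
        measure_pmf.prob (CC r)
          {s. 3 * ln (real m) * ln (2 * real m / \<beta>) / \<epsilon> \<le> real_of_int (linf_dist m r s)} \<le> \<beta>)"

definition exp_median_weight :: "real \<Rightarrow> real set \<Rightarrow> real \<Rightarrow> real" where
  "exp_median_weight \<epsilon> S z =
     exp (- (\<epsilon> / 2) * real_of_int \<bar>rank_in S z - \<lfloor>real (card S) / 2\<rfloor>\<bar>)"

definition exp_median :: "real \<Rightarrow> real \<Rightarrow> real set \<Rightarrow> real measure" where
  "exp_median b \<epsilon> S = density lborel (\<lambda>z. ennreal
     (indicator {0..b} z * exp_median_weight \<epsilon> S z /
      (LINT y:{0..b}|lborel. exp_median_weight \<epsilon> S y)))"

definition slice :: "real set \<Rightarrow> int \<Rightarrow> int \<Rightarrow> real set" where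
  "slice X h k = order_stat X ` {k - h..k + h}"

definition slice_radius :: "int \<Rightarrow> int" where
  "slice_radius len = \<lceil>real_of_int (len - 1) / 2\<rceil>"

text \<open>
  \<open>CC\<close> and \<open>SQ\<close> stand for the two randomized subroutines, already instantiated with their
  privacy parameters. The parameter \<open>w\<close> of the algorithm enters only through the
  requirement on its input ranks, which is stated where the algorithm is used.
\<close>

definition SliceQuantiles ::
    "nat \<Rightarrow> real \<Rightarrow> ((nat \<Rightarrow> int) \<Rightarrow> (nat \<Rightarrow> int) pmf) \<Rightarrow> (real set \<Rightarrow> real measure) \<Rightarrow>
     int \<Rightarrow> real \<Rightarrow> (nat \<Rightarrow> int) \<Rightarrow> real set \<Rightarrow> (nat \<Rightarrow> real) measure" where
  "SliceQuantiles m b CC SQ len \<gamma> r X =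
     (let h = slice_radius len in
      measure_pmf (CC r) \<bind> (\<lambda>s.
      measure_pmf (bernoulli_pmf \<gamma>) \<bind> (\<lambda>heads.
        if heads \<or> s \<notin> Good m (card X) (real_of_int h)
        then Pi\<^sub>M {1..m} (\<lambda>_. uniform_measure lborel {0..b})
        else Pi\<^sub>M {1..m} (\<lambda>i. SQ (slice X h (s i))))))"

end

theory Submission
  imports Defs
begin

text \<open>
  The rank of \<open>z\<close> in the slice of radius \<open>h\<close> around \<open>k\<close> is \<open>rank_in X z - (k - h - 1)\<close> clamped to
  \<open>[0, 2 h + 1]\<close>. Hence, when a point is inserted into \<open>X\<close>, a slice keeps its rank function, up to
  moving its centre by one, unless it is close to the new point, and then the rank function
  changes by at most one, which costs a factor \<open>exp \<epsilon>\<^sub>2\<close>. Slices around separated centres are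
  disjoint, so only one coordinate is affected.

  Shifting all centres above a threshold is a suffix shift, which costs \<open>exp \<epsilon>\<^sub>1\<close>. For an insertion
  the shift is injective on centres and the bound follows. For a deletion it cannot be injective: \<open>2 h + 1\<close>
  positions of a centre are close to the deleted point and only \<open>2 h\<close> remain. Averaging over all
  \<open>2 h\<close> thresholds gives the factor \<open>1 + 1 / (2 h)\<close>, which is at most the unused \<open>exp \<epsilon>\<^sub>2\<close>, because
  the choice of \<open>h\<close> makes \<open>h * \<epsilon>\<^sub>2 \<ge> 2\<close>. Both arguments need the noisy ranks to be within \<open>w\<close> of
  the true ones, which fails with probability at most \<open>\<delta>\<close>.

  For accuracy the failure probability \<open>\<beta>\<close> is split evenly between the noise of \<open>CC\<close> and the \<open>m\<close>
  exponential mechanisms.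
\<close>

section \<open>Ranks of slices\<close>

lemma order_stat_strict_mono:
  assumes "finite X" "1 \<le> i" "i < j" "j \<le> int (card X)"
  shows "order_stat X i < order_stat X j"
proof -
  have "sorted_wrt (<) (sorted_list_of_set X)" by simp
  moreover have "nat (i - 1) < nat (j - 1)" "nat (j - 1) < length (sorted_list_of_set X)"
    using assms by auto
  ultimately show ?thesis unfolding order_stat_def by (rule sorted_wrt_nth_less)
qed

lemma inj_on_order_stat:
  assumes "finite X"
  shows "inj_on (order_stat X) {1..int (card X)}"
proof (rule linorder_inj_onI)
  fix i j assume "i < j" "i \<in> {1..int (card X)}" "j \<in> {1..int (card X)}"
  then show "order_stat X i \<noteq> order_stat X j"
    using order_stat_strict_mono[OF assms, of i j] by auto
qed auto

lemma order_stat_image: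
  assumes "finite X"
  shows "order_stat X ` {1..int (card X)} = X"
proof (rule card_subset_eq[OF assms])
  show "order_stat X ` {1..int (card X)} \<subseteq> X"
  proof safe
    fix i assume "i \<in> {1..int (card X)}"
    then have "nat (i - 1) < length (sorted_list_of_set X)" by auto
    then have "order_stat X i \<in> set (sorted_list_of_set X)"
      unfolding order_stat_def by (rule nth_mem)
    then show "order_stat X i \<in> X" using assms by simp
  qed
  show "card (order_stat X ` {1..int (card X)}) = card X"
    using card_image[OF inj_on_order_stat[OF assms]] by simp
qed

text \<open>The indices \<open>j\<close> with \<open>order_stat X j < z\<close> are as many as the
  points below \<open>z\<close>, and by monotonicity they form an initial segment. This translates
  between positions and ranks throughout.\<close>

lemma order_stat_less_iff:
  assumes "finite X" "1 \<le> i" "i \<le> int (card X)"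
  shows "order_stat X i < z \<longleftrightarrow> i \<le> rank_in X z"
proof -
  define A where "A = {j \<in> {1..int (card X)}. order_stat X j < z}"
  have fin: "finite A"
    unfolding A_def by (rule finite_subset[of _ "{1..int (card X)}"]) auto
  have "{x \<in> X. x < z} = {x \<in> order_stat X ` {1..int (card X)}. x < z}"
    by (simp only: order_stat_image[OF assms(1)])
  also have "\<dots> = order_stat X ` A"
    unfolding A_def by blast
  finally have "{x \<in> X. x < z} = order_stat X ` A" .
  moreover have "inj_on (order_stat X) A"
    by (rule inj_on_subset[OF inj_on_order_stat[OF assms(1)]]) (auto simp: A_def)
  ultimately have rank: "rank_in X z = int (card A)"
    by (simp add: rank_in_def card_image)
  show ?thesis
  proof
    assume *: "order_stat X i < z"
    have "j \<in> A" if "j \<in> {1..i}" for j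
      using order_stat_strict_mono[OF assms(1), of j i] assms(3) * that
      by (cases "j = i") (auto simp: A_def)
    then have "{1..i} \<subseteq> A" by blast
    then show "i \<le> rank_in X z"
      using card_mono[OF fin, of "{1..i}"] assms(2) rank by simp
  next
    assume le: "i \<le> rank_in X z"
    show "order_stat X i < z"
    proof (rule ccontr)
      assume *: "\<not> order_stat X i < z"
      have "j \<in> {1..i - 1}" if "j \<in> A" for j
        using order_stat_strict_mono[OF assms(1,2), of j] * that
        by (cases "j = i"; cases "i < j") (auto simp: A_def)
      then have "A \<subseteq> {1..i - 1}" by blast
      then have "card A \<le> card {1..i - 1}" by (intro card_mono) auto
      then show False using le rank assms(2) by simp
    qed
  qed
qed

section \<open>Ranks inside a slice and their change under insertion\<close>

lemma finite_slice [simp]: "finite (slice X h k)"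
  by (simp add: slice_def)

lemma card_slice:
  assumes "finite X" "1 \<le> k - h" "k + h \<le> int (card X)"
  shows "card (slice X h k) = nat (2 * h + 1)"
  unfolding slice_def
  by (subst card_image[OF inj_on_subset[OF inj_on_order_stat[OF assms(1)]]])
    (use assms in auto)

lemma rank_in_nonneg: "0 \<le> rank_in X z"
  by (simp add: rank_in_def)

lemma rank_in_le_card: "finite X \<Longrightarrow> rank_in X z \<le> int (card X)"
  by (auto simp: rank_in_def intro!: card_mono)

text \<open>By \<open>order_stat_less_iff\<close> the points of the slice below \<open>z\<close> are
  the order statistics with indices from \<open>k - h\<close> to
  \<open>min (k + h) (rank_in X z)\<close>; \<open>max 0\<close> covers the empty range.\<close>

lemma rank_in_slice:
  assumes "finite X" "0 \<le> h" "1 \<le> k - h" "k + h \<le> int (card X)"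
  shows "rank_in (slice X h k) z = max 0 (min (2 * h + 1) (rank_in X z - (k - h - 1)))"
proof -
  have "{x \<in> slice X h k. x < z} = order_stat X ` {k - h..min (k + h) (rank_in X z)}"
    using order_stat_less_iff[OF assms(1), of _ z] assms(3,4) by (auto simp: slice_def)
  moreover have "inj_on (order_stat X) {k - h..min (k + h) (rank_in X z)}"
    by (rule inj_on_subset[OF inj_on_order_stat[OF assms(1)]]) (use assms in auto)
  ultimately show ?thesis
    by (auto simp: rank_in_def card_image min_def max_def)
qed

lemma rank_in_insert:
  assumes "finite X" "x \<notin> X"
  shows "rank_in (insert x X) z = rank_in X z + (if x < z then 1 else 0)"
proof -
  have "{y \<in> insert x X. y < z} = (if x < z then insert x {y \<in> X. y < z} else {y \<in> X. y < z})"
    by auto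
  then show ?thesis using assms by (auto simp: rank_in_def)
qed

lemma rank_in_mono: "finite X \<Longrightarrow> y \<le> z \<Longrightarrow> rank_in X y \<le> rank_in X z"
  by (auto simp: rank_in_def intro!: card_mono)

text \<open>Before clamping, the ranks differ by the indicator of \<open>x < z\<close> minus
  \<open>k' - k\<close>, and clamping does not increase distances. With \<open>k' = k\<close> and
  the slice below \<open>x\<close>, a change is possible only for \<open>z > x\<close>, where both
  ranks clamp to \<open>2 * h + 1\<close>. With \<open>k' = k + 1\<close> and the slice above
  \<open>x\<close>, the changes cancel for \<open>z > x\<close>, and both ranks clamp to
  \<open>0\<close> otherwise.\<close>

lemma slice_insert_ranks:
  assumes "finite X" "x \<notin> X" "0 \<le> h" "k' = k \<or> k' = k + 1"
    and "1 \<le> k - h" "k + h \<le> int (card X)" "1 \<le> k' - h" "k' + h \<le> int (card X) + 1"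
  shows "\<bar>rank_in (slice X h k) z - rank_in (slice (insert x X) h k') z\<bar> \<le> 1"
    and "k' = k \<Longrightarrow> k + h \<le> rank_in X x \<Longrightarrow>
      rank_in (slice (insert x X) h k') z = rank_in (slice X h k) z"
    and "k' = k + 1 \<Longrightarrow> rank_in X x < k - h \<Longrightarrow>
      rank_in (slice (insert x X) h k') z = rank_in (slice X h k) z"
proof -
  have r: "rank_in (slice X h k) z = max 0 (min (2 * h + 1) (rank_in X z - (k - h - 1)))"
    using assms by (intro rank_in_slice) auto
  have r': "rank_in (slice (insert x X) h k') z =
      max 0 (min (2 * h + 1) (rank_in X z + (if x < z then 1 else 0) - (k' - h - 1)))"
    using assms by (subst rank_in_slice) (auto simp: rank_in_insert)
  show "\<bar>rank_in (slice X h k) z - rank_in (slice (insert x X) h k') z\<bar> \<le> 1"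
    unfolding r r' using assms(4) by (cases "x < z"; auto)
  show "rank_in (slice (insert x X) h k') z = rank_in (slice X h k) z"
    if "k' = k" "k + h \<le> rank_in X x"
    unfolding r r' using that rank_in_mono[OF assms(1), of x z] assms(3)
    by (cases "x < z"; simp)
  show "rank_in (slice (insert x X) h k') z = rank_in (slice X h k) z"
    if "k' = k + 1" "rank_in X x < k - h"
    unfolding r r' using that rank_in_mono[OF assms(1), of z x] assms(3)
    by (cases "x < z"; simp)
qed

section \<open>The exponential mechanism\<close>

lemma measurable_rank_in:
  assumes "finite S"
  shows "(\<lambda>z. real_of_int (rank_in S z)) \<in> borel_measurable borel"
proof -
  have "real_of_int (rank_in S z) = (\<Sum>x\<in>S. if x < z then 1 else 0)" for z
    using assms by (simp add: rank_in_def sum.If_cases Int_def)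
  then show ?thesis by simp
qed

lemma measurable_exp_median_weight:
  assumes "finite S"
  shows "exp_median_weight \<epsilon> S \<in> borel_measurable borel"
proof -
  note [measurable] = measurable_rank_in[OF assms]
  show ?thesis unfolding exp_median_weight_def of_int_abs of_int_diff by measurable
qed

lemma exp_median_weight_pos: "0 < exp_median_weight \<epsilon> S z"
  by (simp add: exp_median_weight_def)

lemma exp_median_weight_le_1: "0 \<le> \<epsilon> \<Longrightarrow> exp_median_weight \<epsilon> S z \<le> 1"
  by (simp add: exp_median_weight_def)

lemma integrable_exp_median_weight:
  assumes "finite S" "0 \<le> \<epsilon>"
  shows "set_integrable lborel {0..b} (exp_median_weight \<epsilon> S)"
  unfolding set_integrable_def
proof (rule integrableI_bounded_set_indicator[where B=1])
  show "exp_median_weight \<epsilon> S \<in> borel_measurable lborel"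
    using measurable_exp_median_weight[OF assms(1)] by simp
qed (auto simp: exp_median_weight_le_1[OF assms(2)] less_imp_le[OF exp_median_weight_pos] emeasure_lborel_Icc_eq)

lemma set_lebesgue_integral_const_Icc:
  "0 \<le> b \<Longrightarrow> (LINT y:{0..b}|lborel. c) = b * (c::real)"
  by (simp add: set_lebesgue_integral_def)

text \<open>Rank and target both lie between \<open>0\<close> and \<open>card S\<close>. The bound
  is crude; it serves to make the normalizer positive.\<close>

lemma exp_median_weight_lower:
  assumes "finite S" "0 \<le> \<epsilon>"
  shows "exp (- (\<epsilon> / 2) * real (card S)) \<le> exp_median_weight \<epsilon> S z"
proof -
  have "\<lfloor>real (card S) / 2\<rfloor> \<ge> 0" "\<lfloor>real (card S) / 2\<rfloor> \<le> int (card S)" by (auto, linarith)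
  then have "\<bar>rank_in S z - \<lfloor>real (card S) / 2\<rfloor>\<bar> \<le> int (card S)"
    using rank_in_nonneg[of S z] rank_in_le_card[OF assms(1), of z] by linarith
  then have "real_of_int \<bar>rank_in S z - \<lfloor>real (card S) / 2\<rfloor>\<bar> \<le> real (card S)"
    by linarith
  then show ?thesis
    unfolding exp_median_weight_def using assms(2) by (auto intro!: mult_left_mono)
qed

lemma exp_median_normalizer_pos:
  assumes "finite S" "0 \<le> \<epsilon>" "0 < b"
  shows "0 < (LINT y:{0..b}|lborel. exp_median_weight \<epsilon> S y)"
proof -
  have "0 < b * exp (- (\<epsilon> / 2) * real (card S))" using assms(3) by simp
  also have "\<dots> = (LINT y:{0..b}|lborel. exp (- (\<epsilon> / 2) * real (card S)))"
    using assms(3) by (subst set_lebesgue_integral_const_Icc) auto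
  also have "\<dots> \<le> (LINT y:{0..b}|lborel. exp_median_weight \<epsilon> S y)"
    by (rule set_integral_mono[OF _ integrable_exp_median_weight[OF assms(1,2)]
          exp_median_weight_lower[OF assms(1,2)]])
      (auto simp: set_integrable_def emeasure_lborel_Icc_eq intro!: integrable_real_indicator)
  finally show ?thesis .
qed

section \<open>The exponential mechanism as a probability measure, and its stability\<close>

lemma sets_exp_median [measurable_cong, simp]: "sets (exp_median b \<epsilon> S) = sets borel"
  by (simp add: exp_median_def)

lemma space_exp_median [simp]: "space (exp_median b \<epsilon> S) = UNIV"
  by (simp add: exp_median_def)

lemma measurable_exp_median_density:
  assumes "finite S"
  shows "(\<lambda>z. ennreal (indicator {0..b} z * exp_median_weight \<epsilon> S z / c)) \<in> borel_measurable borel"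
proof -
  note [measurable] = measurable_exp_median_weight[OF assms]
  show ?thesis by measurable
qed

lemma emeasure_exp_median:
  assumes "finite S" "A \<in> sets borel"
  shows "emeasure (exp_median b \<epsilon> S) A = (\<integral>\<^sup>+z. ennreal (indicator {0..b} z * exp_median_weight \<epsilon> S z /
      (LINT y:{0..b}|lborel. exp_median_weight \<epsilon> S y)) * indicator A z \<partial>lborel)"
  unfolding exp_median_def using assms measurable_exp_median_density[OF assms(1)]
  by (subst emeasure_density) auto

lemma prob_space_exp_median:
  assumes "finite S" "0 \<le> \<epsilon>" "0 < b"
  shows "prob_space (exp_median b \<epsilon> S)"
proof (rule prob_spaceI)
  let ?Z = "LINT y:{0..b}|lborel. exp_median_weight \<epsilon> S y"
  have Z: "0 < ?Z" by (rule exp_median_normalizer_pos[OF assms])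
  have int: "integrable lborel (\<lambda>z. indicator {0..b} z * exp_median_weight \<epsilon> S z / ?Z)"
    using integrable_exp_median_weight[OF assms(1,2), of b] by (simp add: set_integrable_def)
  have "emeasure (exp_median b \<epsilon> S) (space (exp_median b \<epsilon> S)) =
      (\<integral>\<^sup>+z. ennreal (indicator {0..b} z * exp_median_weight \<epsilon> S z / ?Z) \<partial>lborel)"
    by (simp add: emeasure_exp_median[OF assms(1)])
  also have "\<dots> = ennreal (\<integral>z. indicator {0..b} z * exp_median_weight \<epsilon> S z / ?Z \<partial>lborel)"
    using Z by (intro nn_integral_eq_integral[OF int]) (auto simp: less_imp_le[OF exp_median_weight_pos])
  also have "(\<integral>z. indicator {0..b} z * exp_median_weight \<epsilon> S z / ?Z \<partial>lborel) = ?Z / ?Z"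
    by (simp add: set_lebesgue_integral_def)
  finally show "emeasure (exp_median b \<epsilon> S) (space (exp_median b \<epsilon> S)) = 1" using Z by simp
qed

text \<open>The mechanism sees its dataset only through the cardinality and the rank function, so
  different slices may give the same law.\<close>

lemma exp_median_cong:
  assumes "card S = card S'" "\<And>z. rank_in S z = rank_in S' z"
  shows "exp_median b \<epsilon> S = exp_median b \<epsilon> S'"
  using assms by (simp add: exp_median_def exp_median_weight_def)

lemma exp_median_weight_ratio:
  assumes "card S = card S'" "\<bar>rank_in S z - rank_in S' z\<bar> \<le> 1" "0 \<le> \<epsilon>"
  shows "exp_median_weight \<epsilon> S z \<le> exp (\<epsilon> / 2) * exp_median_weight \<epsilon> S' z"
proof -
  let ?c = "\<lfloor>real (card S) / 2\<rfloor>"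
  have "\<bar>rank_in S' z - ?c\<bar> \<le> 1 + \<bar>rank_in S z - ?c\<bar>" using assms(2) by linarith
  then have "real_of_int \<bar>rank_in S' z - ?c\<bar> \<le> 1 + real_of_int \<bar>rank_in S z - ?c\<bar>" by linarith
  from mult_left_mono[OF this, of "\<epsilon> / 2"] assms(3) show ?thesis
    unfolding exp_median_weight_def assms(1)[symmetric] exp_add[symmetric]
    by (simp add: algebra_simps)
qed

text \<open>The weight and the normalizer each change by a factor of at most
  \<open>exp (\<epsilon> / 2)\<close>; the densities are compared pointwise and then integrated over
  \<open>A\<close>.\<close>

lemma emeasure_exp_median_ratio:
  assumes fin: "finite S" "finite S'" and card: "card S = card S'"
    and rank: "\<And>z. \<bar>rank_in S z - rank_in S' z\<bar> \<le> 1" and "0 \<le> \<epsilon>" "0 < b" and A: "A \<in> sets borel"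
  shows "emeasure (exp_median b \<epsilon> S) A \<le> ennreal (exp \<epsilon>) * emeasure (exp_median b \<epsilon> S') A"
proof -
  let ?W = "exp_median_weight \<epsilon> S" and ?W' = "exp_median_weight \<epsilon> S'"
  let ?Z = "LINT y:{0..b}|lborel. ?W y" and ?Z' = "LINT y:{0..b}|lborel. ?W' y"
  have Z: "0 < ?Z" "0 < ?Z'" using exp_median_normalizer_pos assms by blast+
  have W: "?W z \<le> exp (\<epsilon> / 2) * ?W' z" and W': "?W' z \<le> exp (\<epsilon> / 2) * ?W z" for z
    using exp_median_weight_ratio card rank[of z] \<open>0 \<le> \<epsilon>\<close> by (auto simp: abs_minus_commute)
  have "?Z' \<le> (LINT y:{0..b}|lborel. exp (\<epsilon> / 2) * ?W y)"
    by (intro set_integral_mono set_integrable_mult_right integrable_exp_median_weight fin W' \<open>0 \<le> \<epsilon>\<close>)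
  then have ZZ: "?Z' \<le> exp (\<epsilon> / 2) * ?Z" by simp
  have key: "indicator {0..b} z * ?W z / ?Z \<le> exp \<epsilon> * (indicator {0..b} z * ?W' z / ?Z')" for z
  proof -
    have "?W z * ?Z' \<le> (exp (\<epsilon> / 2) * ?W' z) * (exp (\<epsilon> / 2) * ?Z)"
      using W[of z] ZZ Z exp_median_weight_pos[of \<epsilon> S' z] by (intro mult_mono) auto
    also have "\<dots> = exp \<epsilon> * ?W' z * ?Z"
      using exp_add[of "\<epsilon> / 2" "\<epsilon> / 2"] by simp
    finally show ?thesis using Z by (auto simp: field_simps indicator_def)
  qed
  have "emeasure (exp_median b \<epsilon> S) A \<le>
      (\<integral>\<^sup>+z. ennreal (exp \<epsilon> * (indicator {0..b} z * ?W' z / ?Z')) * indicator A z \<partial>lborel)"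
    unfolding emeasure_exp_median[OF fin(1) A]
    by (intro nn_integral_mono mult_right_mono ennreal_leI key) simp
  also have "\<dots> = (\<integral>\<^sup>+z. ennreal (exp \<epsilon>) * (ennreal (indicator {0..b} z * ?W' z / ?Z') * indicator A z) \<partial>lborel)"
    by (simp only: ennreal_mult'[OF exp_ge_zero] mult.assoc)
  also have "\<dots> = ennreal (exp \<epsilon>) * emeasure (exp_median b \<epsilon> S') A"
    unfolding emeasure_exp_median[OF fin(2) A]
    using measurable_exp_median_density[OF fin(2)] A
    by (intro nn_integral_cmult borel_measurable_times_ennreal) auto
  finally show ?thesis .
qed

section \<open>Transport of expectations and product measures\<close>

text \<open>On the complement of \<open>G\<close> the integrand is replaced by \<open>1\<close>.
  What remains is a finite sum, which can be regrouped freely.\<close>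

lemma expectation_le_finite_sum:
  fixes p :: "'a pmf" and f :: "'a \<Rightarrow> real"
  assumes "finite G" "\<And>s. 0 \<le> f s" "\<And>s. f s \<le> 1"
  shows "measure_pmf.expectation p f \<le> (\<Sum>s\<in>G. pmf p s * f s) + measure_pmf.prob p (- G)"
proof -
  have int: "integrable p g" if "\<And>s. \<bar>g s\<bar> \<le> 1" for g :: "'a \<Rightarrow> real"
    using that by (intro measure_pmf.integrable_const_bound[where B=1]) auto
  have "measure_pmf.expectation p f \<le>
      measure_pmf.expectation p (\<lambda>s. f s * indicator G s + indicator (- G) s)"
    using assms by (intro integral_mono int Bochner_Integration.integrable_add)
      (auto simp: indicator_def abs_le_iff)
  also have "\<dots> = measure_pmf.expectation p (\<lambda>s. f s * indicator G s) + measure_pmf.prob p (- G)"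
    using assms by (subst Bochner_Integration.integral_add) (auto simp: indicator_def abs_le_iff intro!: int)
  also have "measure_pmf.expectation p (\<lambda>s. f s * indicator G s) = (\<Sum>s\<in>G. pmf p s * f s)"
    by (subst integral_measure_pmf_real[OF assms(1)])
      (auto simp: indicator_def mult.commute intro!: sum.cong split: if_splits)
  finally show ?thesis .
qed

lemma finite_sum_le_expectation:
  fixes p :: "'a pmf" and f :: "'a \<Rightarrow> real"
  assumes "finite G" "\<And>s. 0 \<le> f s" "\<And>s. f s \<le> 1"
  shows "(\<Sum>s\<in>G. pmf p s * f s) \<le> measure_pmf.expectation p f"
proof -
  have int: "integrable p g" if "\<And>s. \<bar>g s\<bar> \<le> 1" for g :: "'a \<Rightarrow> real"
    using that by (intro measure_pmf.integrable_const_bound[where B=1]) auto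
  have "(\<Sum>s\<in>G. pmf p s * f s) = measure_pmf.expectation p (\<lambda>s. f s * indicator G s)"
    by (subst integral_measure_pmf_real[OF assms(1)])
      (auto simp: indicator_def mult.commute intro!: sum.cong split: if_splits)
  also have "\<dots> \<le> measure_pmf.expectation p f"
    using assms by (intro integral_mono int) (auto simp: indicator_def abs_le_iff)
  finally show ?thesis .
qed

text \<open>Each map \<open>F \<theta>\<close> carries the mass at \<open>s\<close> to
  \<open>F \<theta> s\<close> at cost \<open>c\<close>. Averaging over \<theta>, a target
  \<open>u\<close> is charged once per preimage, so \<open>N\<close> need only bound the average
  number of preimages; no single \<open>F \<theta>\<close> has to be injective.\<close>

lemma expectation_le_of_average_transport:
  fixes p :: "'a pmf" and f g :: "'a \<Rightarrow> real"
  assumes G: "finite G" and N: "0 \<le> N" and T: "finite T" "T \<noteq> {}"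
    and f: "\<And>s. 0 \<le> f s" "\<And>s. f s \<le> 1" and g: "\<And>s. 0 \<le> g s" "\<And>s. g s \<le> 1"
    and c: "0 \<le> c"
    and step: "\<And>\<theta> s. \<theta> \<in> T \<Longrightarrow> s \<in> G \<Longrightarrow> pmf p s * f s \<le> c * (pmf p (F \<theta> s) * g (F \<theta> s))"
    and mult: "\<And>u. u \<in> (\<Union>\<theta>\<in>T. F \<theta> ` G) \<Longrightarrow>
      (\<Sum>\<theta>\<in>T. real (card {s \<in> G. F \<theta> s = u})) \<le> N * real (card T)"
  shows "measure_pmf.expectation p f \<le> c * N * measure_pmf.expectation p g + measure_pmf.prob p (- G)"
proof -
  define u where "u = (\<lambda>s. pmf p s * g s)"
  define U where "U = (\<Union>\<theta>\<in>T. F \<theta> ` G)"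
  have u: "0 \<le> u s" for s by (simp add: u_def g)
  have U: "finite U" unfolding U_def using G T by auto
  have T0: "0 < real (card T)" using T by (simp add: card_gt_0_iff)
  have "real (card T) * (\<Sum>s\<in>G. pmf p s * f s) = (\<Sum>\<theta>\<in>T. \<Sum>s\<in>G. pmf p s * f s)" by simp
  also have "\<dots> \<le> (\<Sum>\<theta>\<in>T. \<Sum>s\<in>G. c * u (F \<theta> s))"
    unfolding u_def by (intro sum_mono step)
  also have "\<dots> = c * (\<Sum>\<theta>\<in>T. \<Sum>s\<in>G. u (F \<theta> s))" by (simp add: sum_distrib_left)
  \<comment> \<open>The sum over sources is regrouped by the target, which brings in the size of
    each fibre.\<close>
  also have "(\<Sum>\<theta>\<in>T. \<Sum>s\<in>G. u (F \<theta> s)) = (\<Sum>\<theta>\<in>T. \<Sum>y\<in>U. \<Sum>s\<in>{s \<in> G. F \<theta> s = y}. u (F \<theta> s))"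
    by (intro sum.cong refl sum.group[symmetric] G U) (auto simp: U_def)
  also have "\<dots> = (\<Sum>\<theta>\<in>T. \<Sum>y\<in>U. real (card {s \<in> G. F \<theta> s = y}) * u y)"
    by (intro sum.cong refl) simp
  also have "\<dots> = (\<Sum>y\<in>U. (\<Sum>\<theta>\<in>T. real (card {s \<in> G. F \<theta> s = y})) * u y)"
    by (subst sum.swap) (simp add: sum_distrib_right)
  also have "\<dots> \<le> (\<Sum>y\<in>U. N * real (card T) * u y)"
    by (intro sum_mono mult_right_mono mult u) (simp add: U_def)
  also have "\<dots> = N * real (card T) * (\<Sum>y\<in>U. pmf p y * g y)"
    by (simp add: sum_distrib_left u_def)
  finally have "real (card T) * (\<Sum>s\<in>G. pmf p s * f s) \<le>
      c * (N * real (card T) * (\<Sum>y\<in>U. pmf p y * g y))"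
    using c by (simp add: mult_left_mono)
  then have "real (card T) * (\<Sum>s\<in>G. pmf p s * f s) \<le>
      real (card T) * (c * N * (\<Sum>y\<in>U. pmf p y * g y))" by (simp add: mult_ac)
  then have le: "(\<Sum>s\<in>G. pmf p s * f s) \<le> c * N * (\<Sum>y\<in>U. pmf p y * g y)"
    using T0 by simp
  have "c * N * (\<Sum>y\<in>U. pmf p y * g y) \<le> c * N * measure_pmf.expectation p g"
    using c N by (intro mult_left_mono finite_sum_le_expectation U g) auto
  then show ?thesis using le expectation_le_finite_sum[OF G, of f p, OF f] by linarith
qed

text \<open>Fubini with coordinate \<open>i\<close> innermost: the hypothesis bounds the measure of
  every section of \<open>S\<close>, and the product of the remaining factors is the same on both
  sides.\<close>

lemma emeasure_PiM_le_component:
  fixes M N :: "'i \<Rightarrow> 'a measure"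
  assumes I: "finite I" "i \<in> I"
    and M: "\<And>j. j \<in> I \<Longrightarrow> prob_space (M j)" and N: "\<And>j. j \<in> I \<Longrightarrow> prob_space (N j)"
    and eq: "\<And>j. j \<in> I \<Longrightarrow> j \<noteq> i \<Longrightarrow> M j = N j"
    and sets: "sets (M i) = sets (N i)"
    and le: "\<And>A. A \<in> sets (M i) \<Longrightarrow> emeasure (M i) A \<le> c * emeasure (N i) A"
    and S: "S \<in> sets (PiM I M)"
  shows "emeasure (PiM I M) S \<le> c * emeasure (PiM I N) S"
proof -
  define J where "J = I - {i}"
  have IJ: "I = insert i J" "finite J" "i \<notin> J" using I by (auto simp: J_def)
  \<comment> \<open>\<open>product_sigma_finite\<close> asks for sigma-finite factors at all
    indices, so the families are completed by a point mass outside \<open>I\<close>.\<close>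
  define M' where "M' = (\<lambda>j. if j \<in> I then M j else return (count_space UNIV) undefined)"
  define N' where "N' = (\<lambda>j. if j \<in> I then N j else return (count_space UNIV) undefined)"
  have pM: "prob_space (M' j)" for j unfolding M'_def by (auto intro: M prob_space_return)
  have pN: "prob_space (N' j)" for j unfolding N'_def by (auto intro: N prob_space_return)
  interpret M': product_sigma_finite M'
    by (simp add: product_sigma_finite_def pM prob_space_imp_sigma_finite)
  interpret N': product_sigma_finite N'
    by (simp add: product_sigma_finite_def pN prob_space_imp_sigma_finite)
  have PM: "PiM I M = PiM (insert i J) M'" and PN: "PiM I N = PiM (insert i J) N'"
    unfolding IJ(1)[symmetric] by (auto intro!: PiM_cong simp: M'_def N'_def)
  have PJ: "PiM J N' = PiM J M'"
    by (intro PiM_cong refl) (auto simp: M'_def N'_def J_def eq)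
  have i: "M' i = M i" "N' i = N i" using I by (auto simp: M'_def N'_def)
  have sets_eq: "sets (PiM I M) = sets (PiM I N)"
    by (intro sets_PiM_cong refl) (use eq sets in metis)
  have S': "S \<in> sets (PiM (insert i J) M')" "S \<in> sets (PiM (insert i J) N')"
    using S sets_eq PM PN by auto
  have sec: "(\<lambda>y. x(i := y)) -` S \<inter> space (M i) \<in> sets (M i)" if "x \<in> space (PiM J M')" for x
  proof -
    have "(\<lambda>y. x(i := y)) \<in> measurable (M i) (PiM (insert i J) M')"
      using that unfolding i(1)[symmetric] by (intro measurable_fun_upd[where J=J]) auto
    from measurable_sets[OF this S'(1)] show ?thesis .
  qed
  have ind: "(\<integral>\<^sup>+ y. indicator S (x(i := y)) \<partial>L) = emeasure L ((\<lambda>y. x(i := y)) -` S \<inter> space (M i))"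
    if "x \<in> space (PiM J M')" "sets L = sets (M i)" for x and L :: "'a measure"
  proof -
    have sp: "space L = space (M i)" using that(2) by (rule sets_eq_imp_space_eq)
    have "(\<integral>\<^sup>+ y. indicator S (x(i := y)) \<partial>L) =
        (\<integral>\<^sup>+ y. indicator ((\<lambda>y. x(i := y)) -` S \<inter> space (M i)) y \<partial>L)"
      by (intro nn_integral_cong) (auto simp: sp indicator_def)
    then show ?thesis using sec[OF that(1)] that(2) by simp
  qed
  have "emeasure (PiM I M) S = (\<integral>\<^sup>+ x. (\<integral>\<^sup>+ y. indicator S (x(i := y)) \<partial>M i) \<partial>PiM J M')"
    unfolding PM using S'(1)
    by (simp add: M'.product_nn_integral_insert[OF IJ(2,3)] i flip: nn_integral_indicator)
  also have "\<dots> \<le> (\<integral>\<^sup>+ x. c * (\<integral>\<^sup>+ y. indicator S (x(i := y)) \<partial>N i) \<partial>PiM J M')"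
    using sec sets by (intro nn_integral_mono) (auto simp: ind intro!: le)
  also have "\<dots> = c * (\<integral>\<^sup>+ x. (\<integral>\<^sup>+ y. indicator S (x(i := y)) \<partial>N i) \<partial>PiM J N')"
  proof (subst nn_integral_cmult)
    have "(\<lambda>(x, y). x(i := y)) \<in> measurable (PiM J N' \<Otimes>\<^sub>M N' i) (PiM (insert i J) N')"
      by (rule measurable_add_dim)
    from measurable_compose[OF this borel_measurable_indicator[OF S'(2)]]
    have "(\<lambda>x. \<integral>\<^sup>+ y. indicator S (x(i := y)) \<partial>N' i) \<in> borel_measurable (PiM J N')"
      by (intro sigma_finite_measure.borel_measurable_nn_integral[OF prob_space_imp_sigma_finite[OF pN]])
        (simp add: split_beta')
    then show "(\<lambda>x. \<integral>\<^sup>+ y. indicator S (x(i := y)) \<partial>N i) \<in> borel_measurable (PiM J M')"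
      by (simp add: i PJ)
  qed (simp add: PJ)
  also have "(\<integral>\<^sup>+ x. (\<integral>\<^sup>+ y. indicator S (x(i := y)) \<partial>N i) \<partial>PiM J N') = emeasure (PiM I N) S"
    unfolding PN using S'(2)
    by (simp add: N'.product_nn_integral_insert[OF IJ(2,3)] i flip: nn_integral_indicator)
  finally show ?thesis .
qed

section \<open>Threshold shifts\<close>

text \<open>Stated for all pairs, so that any two entries can be compared without an
  induction.\<close>

definition separated :: "nat \<Rightarrow> int \<Rightarrow> (nat \<Rightarrow> int) \<Rightarrow> bool" where
  "separated m d s \<longleftrightarrow> (\<forall>i\<in>{1..m}. \<forall>j\<in>{1..m}. i < j \<longrightarrow> d \<le> s j - s i)"

lemma separatedD: "separated m d s \<Longrightarrow> i \<in> {1..m} \<Longrightarrow> j \<in> {1..m} \<Longrightarrow> i < j \<Longrightarrow> d \<le> s j - s i"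
  by (simp add: separated_def)

lemma separated_of_consecutive:
  assumes "\<And>i. i \<in> {2..m} \<Longrightarrow> d \<le> s i - s (i - 1)" "0 \<le> d"
  shows "separated m d s"
proof -
  have "1 \<le> i \<Longrightarrow> i + Suc k \<le> m \<Longrightarrow> d \<le> s (i + Suc k) - s i" for i k
  proof (induction k)
    case 0
    then show ?case using assms(1)[of "i + 1"] by simp
  next
    case (Suc k)
    then show ?case using assms(1)[of "i + Suc (Suc k)"] assms(2) by simp
  qed
  note * = this
  show ?thesis unfolding separated_def
  proof (intro ballI impI)
    fix i j assume "i \<in> {1..m}" "j \<in> {1..m}" "i < j"
    then show "d \<le> s j - s i" using *[of i "j - i - 1"] by simp
  qed
qed

text \<open>For an integer half-width the strict gap becomes \<open>2 * h + 1\<close>, which says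
  that consecutive slices occupy disjoint ranges of positions.\<close>

lemma mem_Good_iff:
  "s \<in> Good m n (real_of_int h) \<longleftrightarrow>
    s \<in> int_vecs m \<and> h + 1 \<le> s 1 \<and> (\<forall>i\<in>{2..m}. 2 * h + 1 \<le> s i - s (i - 1)) \<and> s m \<le> int n - h"
proof -
  have "1 \<le> real_of_int (s 1) - real_of_int h \<longleftrightarrow> h + 1 \<le> s 1" by linarith
  moreover have "2 * real_of_int h < real_of_int (s i - s (i - 1)) \<longleftrightarrow> 2 * h + 1 \<le> s i - s (i - 1)" for i
    by linarith
  moreover have "real_of_int (s m) \<le> real n - real_of_int h \<longleftrightarrow> s m \<le> int n - h" by linarith
  ultimately show ?thesis by (simp add: Good_def)
qed

text \<open>\<open>Good\<close> bounds the first entry below and the last one above; since the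
  entries increase, every slice stays within the positions \<open>1\<close> to
  \<open>n\<close>.\<close>

lemma Good_bounds:
  assumes "s \<in> Good m n (real_of_int h)" "0 \<le> h" "i \<in> {1..m}"
  shows "1 \<le> s i - h" "s i + h \<le> int n"
proof -
  have sep: "separated m (2 * h + 1) s"
    using assms(1,2) by (intro separated_of_consecutive) (auto simp: mem_Good_iff)
  have "s 1 \<le> s i"
    using separatedD[OF sep, of 1 i] assms(2,3) by (cases "i = 1") auto
  moreover have "s i \<le> s m"
    using separatedD[OF sep, of i m] assms(2,3) by (cases "i = m") auto
  ultimately show "1 \<le> s i - h" "s i + h \<le> int n" using assms(1) by (auto simp: mem_Good_iff)
qed

text \<open>Room for moving every entry of \<open>s\<close> by one in either direction while staying in \<open>Good\<close>.\<close>

definition well_inside :: "nat \<Rightarrow> nat \<Rightarrow> int \<Rightarrow> (nat \<Rightarrow> int) \<Rightarrow> bool" where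
  "well_inside m n h s \<longleftrightarrow> s \<in> int_vecs m \<and> separated m (2 * h + 2) s \<and>
     (\<forall>i\<in>{1..m}. h + 2 \<le> s i \<and> s i \<le> int n - h - 1)"

text \<open>The cut is by value rather than by index as in \<open>suffix_shift\<close>: it is placed
  relative to the rank of the inserted point, so the index of the cut depends on
  \<open>s\<close>.\<close>

definition threshold_shift :: "nat \<Rightarrow> int \<Rightarrow> int \<Rightarrow> (nat \<Rightarrow> int) \<Rightarrow> nat \<Rightarrow> int" where
  "threshold_shift m \<theta> c s = (\<lambda>i\<in>{1..m}. s i + (if s i < \<theta> then 0 else c))"

lemma threshold_shift_apply:
  "i \<in> {1..m} \<Longrightarrow> threshold_shift m \<theta> c s i = s i + (if s i < \<theta> then 0 else c)"
  by (simp add: threshold_shift_def)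

lemma threshold_shift_mem: "threshold_shift m \<theta> c s \<in> int_vecs m"
  by (simp add: threshold_shift_def int_vecs_def)

text \<open>Separated entries increase, so those below \<theta> occupy an initial segment of
  indices. Thus the privacy guarantee of \<open>CC\<close> applies to threshold shifts.\<close>

lemma threshold_shift_eq_suffix_shift:
  assumes "separated m d s" "0 < d"
  obtains t where "t \<in> {0..m}" "threshold_shift m \<theta> c s = suffix_shift m t c s"
proof -
  define A where "A = {i \<in> {1..m}. s i < \<theta>}"
  \<comment> \<open>The inserted \<open>0\<close> is the cut when no entry lies below
    \<theta>.\<close>
  define t where "t = Max (insert 0 A)"
  have fin: "finite (insert 0 A)" by (simp add: A_def)
  have t: "t \<in> insert 0 A" unfolding t_def by (rule Max_in[OF fin]) simp
  have iff: "s i < \<theta> \<longleftrightarrow> i \<le> t" if "i \<in> {1..m}" for i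
  proof
    assume "s i < \<theta>"
    then show "i \<le> t" unfolding t_def by (intro Max_ge fin) (use that in \<open>auto simp: A_def\<close>)
  next
    assume "i \<le> t"
    then have "t \<in> A" using t that by auto
    then show "s i < \<theta>"
      using separatedD[OF assms(1) that, of t] assms(2) \<open>i \<le> t\<close> by (cases "i = t") (auto simp: A_def)
  qed
  show thesis
  proof
    show "t \<in> {0..m}" using t by (auto simp: A_def)
    show "threshold_shift m \<theta> c s = suffix_shift m t c s"
      unfolding threshold_shift_def suffix_shift_def by (intro restrict_ext) (simp add: iff)
  qed
qed

text \<open>A shift narrows each gap, and each distance to the ends, by at most one, and
  \<open>well_inside\<close> has one unit to spare. The case \<open>c = 0\<close> gives
  \<open>well_inside_Good\<close>.\<close>

lemma well_inside_threshold_shift_Good: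
  assumes "1 \<le> m" "well_inside m n h s" "c \<in> {-1, 0, 1}" "n \<le> n'" "0 \<le> h"
  shows "threshold_shift m \<theta> c s \<in> Good m n' (real_of_int h)"
proof -
  have 1: "(1::nat) \<in> {1..m}" and m: "m \<in> {1..m}" using assms(1) by auto
  have "2 * h + 1 \<le> threshold_shift m \<theta> c s i - threshold_shift m \<theta> c s (i - 1)"
    if "i \<in> {2..m}" for i
  proof -
    have i: "i \<in> {1..m}" "i - 1 \<in> {1..m}" "i - 1 < i" using that by auto
    then have "2 * h + 2 \<le> s i - s (i - 1)"
      using assms(2) separatedD[of m "2 * h + 2" s "i - 1" i] by (simp add: well_inside_def)
    then show ?thesis
      unfolding threshold_shift_apply[OF i(1)] threshold_shift_apply[OF i(2)]
      using assms(3,5) by auto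
  qed
  moreover have "h + 2 \<le> s 1" "s m \<le> int n - h - 1"
    using assms(2) 1 m by (auto simp: well_inside_def)
  ultimately show ?thesis
    using assms(3,4) threshold_shift_apply[OF 1] threshold_shift_apply[OF m]
    by (auto simp: mem_Good_iff threshold_shift_mem)
qed

lemma well_inside_Good:
  assumes "1 \<le> m" "well_inside m n h s" "n \<le> n'" "0 \<le> h"
  shows "s \<in> Good m n' (real_of_int h)"
proof -
  have "threshold_shift m 0 0 s = s"
    using assms(2) by (auto simp: threshold_shift_def well_inside_def int_vecs_def PiE_def
        intro!: extensionalityI[of _ "{1..m}"])
  then show ?thesis using well_inside_threshold_shift_Good[OF assms(1,2) _ assms(3,4), of 0 0] by simp
qed

section \<open>Counting preimages of threshold shifts\<close>

lemma int_vecs_eqI: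
  "s \<in> int_vecs m \<Longrightarrow> u \<in> int_vecs m \<Longrightarrow> (\<And>i. i \<in> {1..m} \<Longrightarrow> s i = u i) \<Longrightarrow> s = u"
  unfolding int_vecs_def by (rule PiE_ext)

text \<open>Unmoved entries stay below \<theta> and moved ones end above it, so the image reveals
  which entries moved.\<close>

lemma inj_on_threshold_shift_up: "inj_on (threshold_shift m \<theta> 1) (int_vecs m)"
proof (rule inj_onI, rule int_vecs_eqI)
  fix s s' i
  assume eq: "threshold_shift m \<theta> 1 s = threshold_shift m \<theta> 1 s'" and i: "i \<in> {1..m}"
  from fun_cong[OF eq, of i] show "s i = s' i"
    by (auto simp: threshold_shift_apply[OF i] split: if_splits)
qed

text \<open>
  Lowering merges the values \<open>\<theta> - 1\<close> and \<open>\<theta>\<close>, so a vector with an entry \<open>\<theta> - 1\<close> has up to two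
  preimages.
\<close>

lemma card_threshold_shift_down:
  assumes "\<And>s. s \<in> G \<Longrightarrow> s \<in> int_vecs m \<and> separated m 2 s"
  shows "card {s \<in> G. threshold_shift m \<theta> (-1) s = u} \<le>
    1 + (if \<exists>i\<in>{1..m}. u i = \<theta> - 1 then 1 else 0)"
proof -
  \<comment> \<open>The two candidate preimages: an entry \<open>\<theta> - 1\<close> of
    \<open>u\<close> is taken as unmoved in \<open>v 0\<close> and as lowered from \<theta> in
    \<open>v 1\<close>.\<close>
  define v where "v = (\<lambda>e. \<lambda>i\<in>{1..m}. u i + (if u i < \<theta> - e then 0 else 1 :: int))"
  have "s \<in> {v 0, v 1}" if s: "s \<in> G" "threshold_shift m \<theta> (-1) s = u" for s
  proof -
    have u: "u i = s i + (if s i < \<theta> then 0 else -1)" if "i \<in> {1..m}" for i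
      using threshold_shift_apply[OF that] s(2) by metis
    have sv: "s \<in> int_vecs m" "v e \<in> int_vecs m" for e
      using assms[OF s(1)] by (auto simp: v_def int_vecs_def)
    show ?thesis
    proof (cases "\<exists>i\<in>{1..m}. s i = \<theta>")
      case True
      then obtain i where i: "i \<in> {1..m}" "s i = \<theta>" by blast
      \<comment> \<open>Separation by \<open>2\<close> forbids \<theta> and
        \<open>\<theta> - 1\<close> from both occurring in \<open>s\<close>, so each entry
        \<open>\<theta> - 1\<close> of \<open>u\<close> came from \<theta>.\<close>
      have "s j \<noteq> \<theta> - 1" if "j \<in> {1..m}" for j
        using assms[OF s(1)] separatedD[of m 2 s i j] separatedD[of m 2 s j i] i that
        by (cases i j rule: linorder_cases) auto
      then have "s = v 1"
        by (intro int_vecs_eqI[OF sv]) (fastforce simp: v_def u split: if_splits)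
      then show ?thesis by simp
    next
      case False
      have "s i = v 0 i" if i: "i \<in> {1..m}" for i
      proof -
        have "s i \<noteq> \<theta>" using False i by blast
        then show ?thesis using i by (auto simp: v_def u[OF i])
      qed
      then have "s = v 0" by (intro int_vecs_eqI[OF sv])
      then show ?thesis by simp
    qed
  qed
  then have sub: "{s \<in> G. threshold_shift m \<theta> (-1) s = u} \<subseteq> {v 0, v 1}" by blast
  show ?thesis
  proof (cases "\<exists>i\<in>{1..m}. u i = \<theta> - 1")
    case True
    have "card {s \<in> G. threshold_shift m \<theta> (-1) s = u} \<le> card {v 0, v 1}"
      by (rule card_mono[OF _ sub]) simp
    also have "\<dots> \<le> 2" by (simp add: card_insert_if)
    finally show ?thesis using True by simp
  next
    case False
    then have "v 0 = v 1"
      unfolding v_def by (intro restrict_ext) force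
    then have "card {s \<in> G. threshold_shift m \<theta> (-1) s = u} \<le> card {v 0}"
      using sub by (intro card_mono) auto
    then show ?thesis using False by simp
  qed
qed

text \<open>A second preimage requires an entry \<open>\<theta> - 1\<close> in \<open>u\<close>.
  Entries of \<open>u\<close> are at least \<open>2 * h + 1\<close> apart while \<open>T\<close>
  consists of \<open>2 * h\<close> consecutive values, so this happens for at most one \<theta>, and
  the total is at most \<open>2 * h + 1\<close>.\<close>

lemma sum_card_threshold_shift_down:
  assumes G: "\<And>s. s \<in> G \<Longrightarrow> s \<in> int_vecs m \<and> separated m 2 s"
    and u: "separated m (2 * h + 1) u" and h: "0 < h" and T: "T = {a + 1..a + 2 * h}"
  shows "(\<Sum>\<theta>\<in>T. real (card {s \<in> G. threshold_shift m \<theta> (-1) s = u})) \<le>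
    (1 + 1 / (2 * real_of_int h)) * real (card T)"
proof -
  define B where "B = {\<theta> \<in> T. \<exists>i\<in>{1..m}. u i = \<theta> - 1}"
  have "\<theta> = \<theta>'" if "\<theta> \<in> B" "\<theta>' \<in> B" for \<theta> \<theta>'
  proof -
    from that obtain i j where ij: "i \<in> {1..m}" "u i = \<theta> - 1" "j \<in> {1..m}" "u j = \<theta>' - 1"
      by (auto simp: B_def)
    have "\<bar>\<theta> - \<theta>'\<bar> < 2 * h" using that by (auto simp: B_def T)
    then have "i = j"
      using separatedD[OF u, of i j] separatedD[OF u, of j i] ij
      by (cases i j rule: linorder_cases) auto
    then show ?thesis using ij by simp
  qed
  then have B: "card B \<le> 1"
    by (metis card_le_Suc0_iff_eq[of B] One_nat_def card.infinite zero_le)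
  have fin: "finite T" by (simp add: T)
  have "(\<Sum>\<theta>\<in>T. real (card {s \<in> G. threshold_shift m \<theta> (-1) s = u})) \<le>
      (\<Sum>\<theta>\<in>T. real (1 + (if \<exists>i\<in>{1..m}. u i = \<theta> - 1 then 1 else 0)))"
    by (intro sum_mono of_nat_mono card_threshold_shift_down G)
  also have "\<dots> = real (card T) + real (card B)"
    using fin by (simp add: sum.distrib B_def flip: sum.inter_filter of_nat_sum)
  also have "\<dots> \<le> real (card T) + 1" using B by simp
  also have "\<dots> = (1 + 1 / (2 * real_of_int h)) * real (card T)"
    using h by (simp add: T field_simps)
  finally show ?thesis .
qed

section \<open>Neighbouring slices\<close>

abbreviation slice_medians :: "nat \<Rightarrow> real \<Rightarrow> real \<Rightarrow> int \<Rightarrow> real set \<Rightarrow> (nat \<Rightarrow> int) \<Rightarrow> (nat \<Rightarrow> real) measure" where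
  "slice_medians m b \<epsilon> h X s \<equiv> PiM {1..m} (\<lambda>i. exp_median b \<epsilon> (slice X h (s i)))"

text \<open>The law of the output given that \<open>CC\<close> returned \<open>s\<close>, for a coin
  that never shows heads.\<close>

definition conditional_output :: "nat \<Rightarrow> real \<Rightarrow> real \<Rightarrow> int \<Rightarrow> real set \<Rightarrow> (nat \<Rightarrow> int) \<Rightarrow> (nat \<Rightarrow> real) measure" where
  "conditional_output m b \<epsilon> h X s =
     (if s \<in> Good m (card X) (real_of_int h) then slice_medians m b \<epsilon> h X s
      else PiM {1..m} (\<lambda>_. uniform_measure lborel {0..b}))"

section \<open>The mechanism as a mixture over the noisy ranks\<close>

lemma conditional_output_Good:
  "s \<in> Good m (card X) (real_of_int h) \<Longrightarrow> conditional_output m b \<epsilon> h X s = slice_medians m b \<epsilon> h X s"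
  by (simp add: conditional_output_def)

lemma sets_conditional_output:
  "sets (conditional_output m b \<epsilon> h X s) = sets (PiM {1..m} (\<lambda>_. borel))"
  by (auto simp: conditional_output_def intro!: sets_PiM_cong)

lemma prob_space_conditional_output:
  assumes "0 \<le> \<epsilon>" "0 < b"
  shows "prob_space (conditional_output m b \<epsilon> h X s)"
  using assms unfolding conditional_output_def
  by (auto intro!: prob_space_PiM prob_space_exp_median prob_space_uniform_measure)

lemma measurable_conditional_output:
  assumes "0 \<le> \<epsilon>" "0 < b"
  shows "conditional_output m b \<epsilon> h X \<in> measurable (count_space UNIV) (subprob_algebra (PiM {1..m} (\<lambda>_. borel)))"
  using prob_space_conditional_output[OF assms]
  by (auto simp: space_subprob_algebra sets_conditional_output intro: prob_space_imp_subprob_space)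

text \<open>For \<gamma> equal to \<open>0\<close> the coin is a point mass at \<open>False\<close>,
  and binding over it disappears.\<close>

lemma SliceQuantiles_eq_bind:
  assumes "0 \<le> \<epsilon>" "0 < b" "h = slice_radius len"
  shows "SliceQuantiles m b CC (exp_median b \<epsilon>) len 0 r X =
    measure_pmf (CC r) \<bind> conditional_output m b \<epsilon> h X"
proof -
  have ber: "bernoulli_pmf 0 = return_pmf False"
  proof (rule pmf_eqI)
    show "pmf (bernoulli_pmf 0) i = pmf (return_pmf False) i" for i
      by (cases i) (auto simp: pmf_return)
  qed
  define U where "U = PiM {1..m} (\<lambda>_. uniform_measure lborel {0..b})"
  have U: "sets U = sets (PiM {1..m} (\<lambda>_. borel))" "prob_space U"
    unfolding U_def using assms(2)
    by (auto intro!: sets_PiM_cong prob_space_PiM prob_space_uniform_measure)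
  have "measure_pmf (bernoulli_pmf 0) \<bind> (\<lambda>heads.
      if heads \<or> s \<notin> Good m (card X) (real_of_int h) then U
      else slice_medians m b \<epsilon> h X s) = conditional_output m b \<epsilon> h X s" for s
  proof -
    have "(\<lambda>heads. if heads then U else conditional_output m b \<epsilon> h X s) \<in>
      measurable (count_space UNIV) (subprob_algebra (PiM {1..m} (\<lambda>_. borel)))"
      using U prob_space_conditional_output[OF assms(1,2)]
      by (auto simp: space_subprob_algebra sets_conditional_output prob_space_imp_subprob_space)
    moreover have "(\<lambda>heads. if heads \<or> s \<notin> Good m (card X) (real_of_int h) then U
        else slice_medians m b \<epsilon> h X s) = (\<lambda>heads. if heads then U else conditional_output m b \<epsilon> h X s)"
      by (auto simp: conditional_output_def U_def)
    ultimately show ?thesis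
      unfolding ber return_pmf.rep_eq by (simp add: bind_return)
  qed
  then show ?thesis
    unfolding U_def SliceQuantiles_def Let_def assms(3)[symmetric] by simp
qed

text \<open>Both privacy and accuracy use the probability of an event in this form, as an
  expectation over the noisy ranks.\<close>

lemma
  assumes "0 \<le> \<epsilon>" "0 < b" "h = slice_radius len"
  shows sets_SliceQuantiles: "sets (SliceQuantiles m b CC (exp_median b \<epsilon>) len 0 r X) = sets (PiM {1..m} (\<lambda>_. borel))"
    and measure_SliceQuantiles: "A \<in> sets (PiM {1..m} (\<lambda>_. borel)) \<Longrightarrow>
      measure (SliceQuantiles m b CC (exp_median b \<epsilon>) len 0 r X) A =
      measure_pmf.expectation (CC r) (\<lambda>s. measure (conditional_output m b \<epsilon> h X s) A)"
proof -
  note eq = SliceQuantiles_eq_bind[OF assms, of m CC r X]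
  have meas: "conditional_output m b \<epsilon> h X \<in> measurable (measure_pmf (CC r)) (subprob_algebra (PiM {1..m} (\<lambda>_. borel)))"
    using measurable_conditional_output[OF assms(1,2)] by simp
  show "sets (SliceQuantiles m b CC (exp_median b \<epsilon>) len 0 r X) = sets (PiM {1..m} (\<lambda>_. borel))"
    unfolding eq by (rule sets_bind) (auto simp: sets_conditional_output)
  show "measure (SliceQuantiles m b CC (exp_median b \<epsilon>) len 0 r X) A =
      measure_pmf.expectation (CC r) (\<lambda>s. measure (conditional_output m b \<epsilon> h X s) A)"
    if "A \<in> sets (PiM {1..m} (\<lambda>_. borel))"
    unfolding eq by (rule measure_pmf.measure_bind[OF meas that])
qed

text \<open>Of any two coordinates at least one has equal rank functions, so at most one coordinate
  \<open>k\<close> differs, and only its factor costs \<open>exp \<epsilon>\<close>.\<close>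

lemma measure_PiM_exp_median_ratio:
  fixes A B :: "nat \<Rightarrow> real set"
  assumes m: "1 \<le> m" and \<epsilon>: "0 \<le> \<epsilon>" and b: "0 < b"
    and fin: "\<And>i. i \<in> {1..m} \<Longrightarrow> finite (A i)" "\<And>i. i \<in> {1..m} \<Longrightarrow> finite (B i)"
    and card: "\<And>i. i \<in> {1..m} \<Longrightarrow> card (A i) = card (B i)"
    and rank: "\<And>i z. i \<in> {1..m} \<Longrightarrow> \<bar>rank_in (A i) z - rank_in (B i) z\<bar> \<le> 1"
    and eq: "\<And>i j. i \<in> {1..m} \<Longrightarrow> j \<in> {1..m} \<Longrightarrow> i < j \<Longrightarrow>
      rank_in (A i) = rank_in (B i) \<or> rank_in (A j) = rank_in (B j)"
    and S: "S \<in> sets (PiM {1..m} (\<lambda>_. borel))"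
  shows "measure (PiM {1..m} (\<lambda>i. exp_median b \<epsilon> (A i))) S \<le>
    exp \<epsilon> * measure (PiM {1..m} (\<lambda>i. exp_median b \<epsilon> (B i))) S"
proof -
  obtain k where k: "k \<in> {1..m}"
    "\<And>i. i \<in> {1..m} \<Longrightarrow> i \<noteq> k \<Longrightarrow> rank_in (A i) = rank_in (B i)"
  proof (cases "\<exists>k\<in>{1..m}. rank_in (A k) \<noteq> rank_in (B k)")
    case True
    then show ?thesis using that eq by (metis linorder_neqE_nat)
  next
    case False
    \<comment> \<open>No coordinate differs; \<open>1\<close> is an arbitrary choice of
      \<open>k\<close>.\<close>
    then show ?thesis using that[of 1] m by auto
  qed
  let ?P = "PiM {1..m} (\<lambda>i. exp_median b \<epsilon> (A i))" and ?Q = "PiM {1..m} (\<lambda>i. exp_median b \<epsilon> (B i))"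
  have P: "prob_space ?P" and Q: "prob_space ?Q"
    using fin \<epsilon> b by (auto intro!: prob_space_PiM prob_space_exp_median)
  have "emeasure ?P S \<le> ennreal (exp \<epsilon>) * emeasure ?Q S"
  proof (rule emeasure_PiM_le_component[OF _ k(1)])
    show "exp_median b \<epsilon> (A i) = exp_median b \<epsilon> (B i)" if "i \<in> {1..m}" "i \<noteq> k" for i
      using card[OF that(1)] k(2)[OF that] by (intro exp_median_cong) auto
    show "emeasure (exp_median b \<epsilon> (A k)) E \<le> ennreal (exp \<epsilon>) * emeasure (exp_median b \<epsilon> (B k)) E"
      if "E \<in> sets (exp_median b \<epsilon> (A k))" for E
      using that fin card rank k(1) \<epsilon> b by (intro emeasure_exp_median_ratio) auto
    have "sets ?P = sets (PiM {1..m} (\<lambda>_. borel))" by (intro sets_PiM_cong) auto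
    then show "S \<in> sets ?P" using S by simp
  qed (use fin \<epsilon> b prob_space_exp_median in auto)
  then have "ennreal (measure ?P S) \<le> ennreal (exp \<epsilon> * measure ?Q S)"
    by (simp only: finite_measure.emeasure_eq_measure[OF prob_space.finite_measure[OF P]]
        finite_measure.emeasure_eq_measure[OF prob_space.finite_measure[OF Q]] ennreal_mult'[OF exp_ge_zero])
  then show ?thesis by (simp add: ennreal_le_iff)
qed

text \<open>The windows for \<theta> are such that slices wholly below \<open>x\<close> keep their
  centre and slices wholly above \<open>x\<close> move with the data. Any other slice may be cut
  either way, and separation leaves at most one of them.\<close>

lemma measure_slice_medians_insert_ratio:
  assumes X: "finite X" "x \<notin> X" and m: "1 \<le> m" and \<epsilon>: "0 \<le> \<epsilon>" "0 < b" and h: "0 \<le> h"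
    and s: "well_inside m (card X) h s" and S: "S \<in> sets (PiM {1..m} (\<lambda>_. borel))"
  shows "\<theta> \<in> {rank_in X x - h + 1..rank_in X x + h + 1} \<Longrightarrow>
      measure (slice_medians m b \<epsilon> h X s) S \<le>
      exp \<epsilon> * measure (slice_medians m b \<epsilon> h (insert x X) (threshold_shift m \<theta> 1 s)) S"
    and "\<theta> \<in> {rank_in X x - h + 2..rank_in X x + h + 1} \<Longrightarrow>
      measure (slice_medians m b \<epsilon> h (insert x X) s) S \<le>
      exp \<epsilon> * measure (slice_medians m b \<epsilon> h X (threshold_shift m \<theta> (-1) s)) S"
proof -
  let ?\<rho> = "rank_in X x"
  have bd: "h + 2 \<le> s i" "s i \<le> int (card X) - h - 1" if "i \<in> {1..m}" for i
    using s that by (auto simp: well_inside_def)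
  have sep: "2 * h + 2 \<le> s j - s i" if "i \<in> {1..m}" "j \<in> {1..m}" "i < j" for i j
    using s separatedD[of m "2 * h + 2" s i j] that by (auto simp: well_inside_def)
  have cardX: "card (insert x X) = card X + 1" using X by simp
  note ins = slice_insert_ranks[OF X h]
  {
    assume \<theta>: "\<theta> \<in> {?\<rho> - h + 1..?\<rho> + h + 1}"
    define s' where "s' = threshold_shift m \<theta> 1 s"
    have s': "s' i = s i + (if s i < \<theta> then 0 else 1)" if "i \<in> {1..m}" for i
      unfolding s'_def by (rule threshold_shift_apply[OF that])
    \<comment> \<open>The side condition says that the slice does not straddle the place where
      \<open>x\<close> enters, between positions \<open>?\<rho>\<close> and
      \<open>?\<rho> + 1\<close>.\<close>
    have eq: "rank_in (slice X h (s i)) = rank_in (slice (insert x X) h (s' i))"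
      if "i \<in> {1..m}" "s i + h \<le> ?\<rho> \<or> ?\<rho> < s i - h" for i
    proof (rule ext)
      fix z
      show "rank_in (slice X h (s i)) z = rank_in (slice (insert x X) h (s' i)) z"
      proof (cases "s i < \<theta>")
        case True
        then have "s' i = s i" "s i + h \<le> ?\<rho>" using s'[OF that(1)] that(2) \<theta> by auto
        then show ?thesis using ins(2)[of "s' i" "s i" z] bd[OF that(1)] h by simp
      next
        case False
        then have "s' i = s i + 1" "?\<rho> < s i - h" using s'[OF that(1)] that(2) \<theta> by auto
        then show ?thesis using ins(3)[of "s' i" "s i" z] bd[OF that(1)] h by simp
      qed
    qed
    show "measure (slice_medians m b \<epsilon> h X s) S \<le>
      exp \<epsilon> * measure (slice_medians m b \<epsilon> h (insert x X) s') S"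
    proof (rule measure_PiM_exp_median_ratio[OF m \<epsilon> _ _ _ _ _ S])
      fix i assume i: "i \<in> {1..m}"
      show "card (slice X h (s i)) = card (slice (insert x X) h (s' i))"
        using bd[OF i] s'[OF i] X cardX by (subst (1 2) card_slice) auto
      show "\<bar>rank_in (slice X h (s i)) z - rank_in (slice (insert x X) h (s' i)) z\<bar> \<le> 1" for z
        using bd[OF i] s'[OF i] by (intro ins(1)) auto
    next
      fix i j assume ij: "i \<in> {1..m}" "j \<in> {1..m}" "i < j"
      \<comment> \<open>Two straddling slices would have centres less than \<open>2 * h\<close>
        apart.\<close>
      then have "(s i + h \<le> ?\<rho> \<or> ?\<rho> < s i - h) \<or> (s j + h \<le> ?\<rho> \<or> ?\<rho> < s j - h)"
        using sep[OF ij] by linarith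
      then show "rank_in (slice X h (s i)) = rank_in (slice (insert x X) h (s' i)) \<or>
          rank_in (slice X h (s j)) = rank_in (slice (insert x X) h (s' j))"
        using eq ij by blast
    qed auto
  }
  {
    assume \<theta>: "\<theta> \<in> {?\<rho> - h + 2..?\<rho> + h + 1}"
    define s' where "s' = threshold_shift m \<theta> (-1) s"
    have s': "s' i = s i + (if s i < \<theta> then 0 else -1)" if "i \<in> {1..m}" for i
      unfolding s'_def by (rule threshold_shift_apply[OF that])
    \<comment> \<open>In \<open>insert x X\<close> the point \<open>x\<close> has position
      \<open>?\<rho> + 1\<close>, so the side condition says that the slice misses
      \<open>x\<close>.\<close>
    have eq: "rank_in (slice (insert x X) h (s i)) = rank_in (slice X h (s' i))"
      if "i \<in> {1..m}" "s i + h \<le> ?\<rho> \<or> ?\<rho> + 1 < s i - h" for i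
    proof (rule ext)
      fix z
      show "rank_in (slice (insert x X) h (s i)) z = rank_in (slice X h (s' i)) z"
      proof (cases "s i < \<theta>")
        case True
        then have *: "s i = s' i" "s' i + h \<le> ?\<rho>" using s'[OF that(1)] that(2) \<theta> by auto
        show ?thesis by (rule ins(2)) (use * bd[OF that(1)] h in auto)
      next
        case False
        then have *: "s i = s' i + 1" "?\<rho> < s' i - h" using s'[OF that(1)] that(2) \<theta> by auto
        show ?thesis by (rule ins(3)) (use * bd[OF that(1)] h in auto)
      qed
    qed
    show "measure (slice_medians m b \<epsilon> h (insert x X) s) S \<le>
      exp \<epsilon> * measure (slice_medians m b \<epsilon> h X s') S"
    proof (rule measure_PiM_exp_median_ratio[OF m \<epsilon> _ _ _ _ _ S])
      fix i assume i: "i \<in> {1..m}"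
      show "card (slice (insert x X) h (s i)) = card (slice X h (s' i))"
        using bd[OF i] s'[OF i] X cardX by (subst (1 2) card_slice) auto
      show "\<bar>rank_in (slice (insert x X) h (s i)) z - rank_in (slice X h (s' i)) z\<bar> \<le> 1" for z
        using bd[OF i] s'[OF i] by (subst abs_minus_commute, intro ins(1)) auto
    next
      fix i j assume ij: "i \<in> {1..m}" "j \<in> {1..m}" "i < j"
      then have "(s i + h \<le> ?\<rho> \<or> ?\<rho> + 1 < s i - h) \<or> (s j + h \<le> ?\<rho> \<or> ?\<rho> + 1 < s j - h)"
        using sep[OF ij] by linarith
      then show "rank_in (slice (insert x X) h (s i)) = rank_in (slice X h (s' i)) \<or>
          rank_in (slice (insert x X) h (s j)) = rank_in (slice X h (s' j))"
        using eq ij by blast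
    qed auto
  }
qed

section \<open>Privacy\<close>

text \<open>For \<open>m = 1\<close> the factor \<open>ln m\<close> makes the accuracy threshold
  \<open>0\<close>, so the failure event is everything and cannot have probability at most
  \<open>1/2\<close>. Hence \<open>m\<close> is at least \<open>2\<close> below.\<close>

lemma is_CC_imp_neq_1:
  assumes "is_CC m \<epsilon> CC"
  shows "m \<noteq> 1"
proof
  assume m: "m = 1"
  obtain r where r: "r \<in> int_vecs m" using threshold_shift_mem by blast
  have "measure_pmf.prob (CC r)
      {s. 3 * ln (real m) * ln (2 * real m / (1/2)) / \<epsilon> \<le> real_of_int (linf_dist m r s)} \<le> 1/2"
    using assms r unfolding is_CC_def by (meson half_gt_zero zero_less_one)
  moreover have "{s. 3 * ln (real m) * ln (2 * real m / (1/2)) / \<epsilon> \<le> real_of_int (linf_dist m r s)} = UNIV"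
    by (auto simp: m linf_dist_def)
  ultimately show False by simp
qed

lemma abs_diff_le_linf_dist: "i \<in> {1..m} \<Longrightarrow> \<bar>r i - s i\<bar> \<le> linf_dist m r s"
  unfolding linf_dist_def by (intro Max_ge) auto

text \<open>Two points at distance at least \<open>1\<close> must fit into the interval. This makes
  \<open>ln b\<close> nonnegative and \<open>h\<close> large enough.\<close>

lemma one_le_of_dataset:
  assumes "dataset b X" "2 \<le> card X"
  shows "1 \<le> b"
proof -
  have "\<not> card X \<le> Suc 0" "finite X" using assms by (auto simp: dataset_def)
  then obtain x y where xy: "x \<in> X" "y \<in> X" "x \<noteq> y" using card_le_Suc0_iff_eq[of X] by blast
  then have "1 \<le> \<bar>x - y\<bar>" "x \<in> {0..b}" "y \<in> {0..b}"
    using assms(1) unfolding dataset_def by blast+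
  then show ?thesis by auto
qed

text \<open>The condition \<open>1 \<le> len\<close> keeps the slice radius nonnegative, since the
  logarithm is negative for small \<open>b\<close>.\<close>

locale slice_quantiles_parameters =
  fixes m :: nat and b \<epsilon>\<^sub>1 \<epsilon>\<^sub>2 \<beta> \<delta> w :: real and len h :: int
    and CC :: "(nat \<Rightarrow> int) \<Rightarrow> (nat \<Rightarrow> int) pmf"
  assumes m1: "1 \<le> m" and b: "0 < b" and \<epsilon>1: "0 < \<epsilon>\<^sub>1" and \<epsilon>2: "0 < \<epsilon>\<^sub>2"
    and \<beta>: "\<beta> \<in> {0<..<1}" and \<delta>: "\<delta> \<in> {0<..<1}" and CC: "is_CC m \<epsilon>\<^sub>1 CC"
    and w: "w = 3 * ln (real m) * ln (2 * real m / \<delta>) / \<epsilon>\<^sub>1"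
    and len: "len = 2 * \<lceil>2 * ln (2 * b * real m / \<beta>) / \<epsilon>\<^sub>2\<rceil> + 1" "1 \<le> len"
    and h: "h = slice_radius len"
begin

abbreviation M :: "(nat \<Rightarrow> int) \<Rightarrow> real set \<Rightarrow> (nat \<Rightarrow> real) measure" where
  "M \<equiv> SliceQuantiles m b CC (exp_median b \<epsilon>\<^sub>2) len 0"

lemma m2: "2 \<le> m"
  using m1 is_CC_imp_neq_1[OF CC] by linarith

lemma h_eq: "h = \<lceil>2 * ln (2 * b * real m / \<beta>) / \<epsilon>\<^sub>2\<rceil>"
  by (simp add: h slice_radius_def len(1))

lemma h_nonneg: "0 \<le> h"
  using len unfolding h_eq by linarith

lemma w_pos: "0 < w"
proof -
  have "1 < 2 * real m / \<delta>" using m2 \<delta> by (simp add: field_simps)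
  then show ?thesis using m2 \<epsilon>1 unfolding w by simp
qed

text \<open>The inequality is strict so that, within \<open>int_vecs m\<close>, the complement is
  exactly the failure event in \<open>is_CC\<close>.\<close>

definition close_vecs :: "real \<Rightarrow> (nat \<Rightarrow> int) \<Rightarrow> (nat \<Rightarrow> int) set" where
  "close_vecs u r = {s \<in> int_vecs m. real_of_int (linf_dist m r s) < u}"

lemma close_vecsD:
  assumes "s \<in> close_vecs u r" "i \<in> {1..m}"
  shows "\<bar>real_of_int (r i) - real_of_int (s i)\<bar> < u"
proof -
  have "real_of_int \<bar>r i - s i\<bar> \<le> real_of_int (linf_dist m r s)"
    using abs_diff_le_linf_dist[OF assms(2)] by (simp only: of_int_le_iff)
  then show ?thesis using assms(1) by (simp add: close_vecs_def)
qed

lemma finite_close_vecs: "finite (close_vecs u r)"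
proof (rule finite_subset)
  show "close_vecs u r \<subseteq> (\<Pi>\<^sub>E i\<in>{1..m}. {r i - \<lceil>u\<rceil>..r i + \<lceil>u\<rceil>})"
  proof
    fix s assume s: "s \<in> close_vecs u r"
    have "s i \<in> {r i - \<lceil>u\<rceil>..r i + \<lceil>u\<rceil>}" if "i \<in> {1..m}" for i
      using close_vecsD[OF s that] unfolding atLeastAtMost_iff by linarith
    then show "s \<in> (\<Pi>\<^sub>E i\<in>{1..m}. {r i - \<lceil>u\<rceil>..r i + \<lceil>u\<rceil>})"
      using s by (auto simp: close_vecs_def int_vecs_def PiE_iff)
  qed
qed (simp add: finite_PiE)

lemma prob_not_close_vecs:
  assumes "r \<in> int_vecs m" "0 < \<eta>"
  shows "measure_pmf.prob (CC r) (- close_vecs (3 * ln (real m) * ln (2 * real m / \<eta>) / \<epsilon>\<^sub>1) r) \<le> \<eta>"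
proof -
  let ?u = "3 * ln (real m) * ln (2 * real m / \<eta>) / \<epsilon>\<^sub>1"
  \<comment> \<open>The complement also contains vectors outside \<open>int_vecs m\<close>;
    restricting to the support removes them.\<close>
  have "measure_pmf.prob (CC r) (- close_vecs ?u r) =
      measure_pmf.prob (CC r) (- close_vecs ?u r \<inter> set_pmf (CC r))"
    by (simp add: measure_Int_set_pmf)
  also have "\<dots> \<le> measure_pmf.prob (CC r) {s. ?u \<le> real_of_int (linf_dist m r s)}"
    using CC assms(1) unfolding is_CC_def
    by (intro measure_pmf.finite_measure_mono) (auto simp: close_vecs_def not_less)
  also have "\<dots> \<le> \<eta>" using CC assms unfolding is_CC_def by blast
  finally show ?thesis .
qed

lemma prob_not_close_vecs_w:
  "r \<in> int_vecs m \<Longrightarrow> measure_pmf.prob (CC r) (- close_vecs w r) \<le> \<delta>"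
  unfolding w using prob_not_close_vecs[of r \<delta>] \<delta> by simp

lemma pmf_CC_threshold_shift:
  assumes "r \<in> int_vecs m" "s \<in> int_vecs m" "separated m d s" "0 < d" "c \<in> {-1, 1}"
  shows "pmf (CC r) s \<le> exp \<epsilon>\<^sub>1 * pmf (CC r) (threshold_shift m \<theta> c s)"
proof -
  obtain t where "t \<in> {0..m}" "threshold_shift m \<theta> c s = suffix_shift m t c s"
    using threshold_shift_eq_suffix_shift[OF assms(3,4)] .
  then show ?thesis using CC assms(1,2,5) unfolding is_CC_def by auto
qed

lemma Good_input:
  assumes "r \<in> Good m n (w + real_of_int h)"
  shows Good_input_mem: "r \<in> int_vecs m"
    and Good_input_ge: "\<And>i. i \<in> {1..m} \<Longrightarrow> 1 + (w + real_of_int h) \<le> real_of_int (r i)"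
    and Good_input_le: "\<And>i. i \<in> {1..m} \<Longrightarrow> real_of_int (r i) \<le> real n - (w + real_of_int h)"
    and Good_input_card: "2 \<le> n"
proof -
  show "r \<in> int_vecs m" using assms by (simp add: Good_def)
  have gap: "0 \<le> r i - r (i - 1)" if "i \<in> {2..m}" for i
  proof -
    have "2 * (w + real_of_int h) < real_of_int (r i - r (i - 1))"
      using assms that by (auto simp: Good_def)
    moreover have "0 \<le> real_of_int h" using h_nonneg by simp
    ultimately have "0 < real_of_int (r i - r (i - 1))" using w_pos by argo
    then show ?thesis by simp
  qed
  have sep: "separated m 0 r" by (intro separated_of_consecutive gap) auto
  show ge: "1 + (w + real_of_int h) \<le> real_of_int (r i)" if "i \<in> {1..m}" for i
  proof -
    have "r 1 \<le> r i" using separatedD[OF sep, of 1 i] that by (cases "i = 1") auto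
    then have "real_of_int (r 1) \<le> real_of_int (r i)" by simp
    moreover have "1 \<le> real_of_int (r 1) - (w + real_of_int h)" using assms by (simp add: Good_def)
    ultimately show ?thesis by linarith
  qed
  show le: "real_of_int (r i) \<le> real n - (w + real_of_int h)" if "i \<in> {1..m}" for i
  proof -
    have "r i \<le> r m" using separatedD[OF sep, of i m] that by (cases "i = m") auto
    then have "real_of_int (r i) \<le> real_of_int (r m)" by simp
    moreover have "real_of_int (r m) \<le> real n - (w + real_of_int h)" using assms by (simp add: Good_def)
    ultimately show ?thesis by linarith
  qed
  \<comment> \<open>The bounds for entry \<open>1\<close> combine to
    \<open>1 + 2 * (w + h) \<le> n\<close>, and \<open>w\<close> is positive.\<close>
  have "real n > 1" using ge[of 1] le[of 1] m1 w_pos h_nonneg by force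
  then show "2 \<le> n" by simp
qed

text \<open>An integer deviation below \<open>w\<close> is at most
  \<open>\<lceil>w\<rceil> - 1\<close>. Two of them reduce a gap of
  \<open>2 * (\<lceil>w\<rceil> + h)\<close> to no less than \<open>2 * h + 2\<close>; the spare
  unit comes from the rounding.\<close>

lemma close_vecs_well_inside:
  assumes r: "r \<in> Good m n (w + real_of_int h)"
    and gap: "\<And>i. i \<in> {2..m} \<Longrightarrow> 2 * (\<lceil>w\<rceil> + h) \<le> r i - r (i - 1)"
    and s: "s \<in> close_vecs w r"
  shows "well_inside m n h s"
proof -
  have "2 * h + 2 \<le> s i - s (i - 1)" if "i \<in> {2..m}" for i
  proof -
    define j c where "j = i - 1" and "c = \<lceil>w\<rceil>"
    have ij: "i \<in> {1..m}" "j \<in> {1..m}" using that by (auto simp: j_def)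
    have "r i - s i \<le> c - 1" "s j - r j \<le> c - 1"
      using close_vecsD[OF s ij(1)] close_vecsD[OF s ij(2)] unfolding c_def by linarith+
    then show ?thesis using gap[OF that] unfolding j_def[symmetric] c_def[symmetric] by presburger
  qed
  then have "separated m (2 * h + 2) s"
    using h_nonneg by (intro separated_of_consecutive) auto
  moreover have "h + 2 \<le> s i" "s i \<le> int n - h - 1" if "i \<in> {1..m}" for i
    using close_vecsD[OF s that] Good_input_ge[OF r that] Good_input_le[OF r that] by linarith+
  ultimately show ?thesis using s by (auto simp: well_inside_def close_vecs_def)
qed

text \<open>For accuracy the noisy ranks have to lie in \<open>Good\<close>: a gap above
  \<open>2 * (w + h)\<close> less two deviations below \<open>w\<close> exceeds
  \<open>2 * h\<close>.\<close>

lemma close_vecs_Good: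
  assumes r: "r \<in> Good m n (w + real_of_int h)" and s: "s \<in> close_vecs w r"
  shows "s \<in> Good m n (real_of_int h)"
proof -
  have "2 * real_of_int h < real_of_int (s i - s (i - 1))" if "i \<in> {2..m}" for i
  proof -
    have "i \<in> {1..m}" "i - 1 \<in> {1..m}" using that by auto
    note close_vecsD[OF s this(1)] close_vecsD[OF s this(2)]
    moreover have "2 * (w + real_of_int h) < real_of_int (r i - r (i - 1))"
      using r that by (auto simp: Good_def)
    ultimately show ?thesis unfolding of_int_diff by argo
  qed
  moreover have "1 \<in> {1..m}" "m \<in> {1..m}" using m1 by auto
  note this[THEN close_vecsD[OF s]] Good_input_ge[OF r this(1)] Good_input_le[OF r this(2)]
  ultimately show ?thesis using s unfolding Good_def close_vecs_def by auto
qed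

text \<open>From \<open>m \<ge> 2\<close>, \<open>b \<ge> 1\<close> and \<open>\<beta> < 1\<close>
  the argument of the logarithm is at least \<open>4\<close>, hence at least
  \<open>exp 1\<close>.\<close>

lemma h_times_\<epsilon>2:
  assumes "1 \<le> b"
  shows "2 \<le> real_of_int h * \<epsilon>\<^sub>2"
proof -
  have "4 * \<beta> \<le> 4" using \<beta> by simp
  also have "4 \<le> 2 * b * real m"
    using mult_mono[of 1 b 2 "real m"] assms m2 by simp
  finally have "4 \<le> 2 * b * real m / \<beta>" using \<beta> by (simp add: field_simps)
  then have "exp 1 \<le> 2 * b * real m / \<beta>" using exp_le by linarith
  then have "1 \<le> ln (2 * b * real m / \<beta>)"
    using b m1 \<beta> by (subst ln_ge_iff) auto
  then have "2 / \<epsilon>\<^sub>2 \<le> 2 * ln (2 * b * real m / \<beta>) / \<epsilon>\<^sub>2" using \<epsilon>2 by (intro divide_right_mono) auto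
  also have "\<dots> \<le> real_of_int h" unfolding h_eq by (rule le_of_int_ceiling)
  finally show ?thesis using \<epsilon>2 by (simp add: field_simps)
qed

lemma multiplicity_le_exp:
  assumes "1 \<le> b"
  shows "0 < h" "1 + 1 / (2 * real_of_int h) \<le> exp \<epsilon>\<^sub>2"
proof -
  show "0 < h" using h_times_\<epsilon>2[OF assms] h_nonneg by (cases "h = 0") auto
  then have "1 / (2 * real_of_int h) \<le> \<epsilon>\<^sub>2"
    using h_times_\<epsilon>2[OF assms] by (simp add: field_simps)
  then show "1 + 1 / (2 * real_of_int h) \<le> exp \<epsilon>\<^sub>2" using exp_ge_add_one_self[of \<epsilon>\<^sub>2] by linarith
qed

text \<open>The budget: \<open>\<epsilon>\<^sub>1\<close> for shifting the noisy ranks, one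
  \<open>\<epsilon>\<^sub>2\<close> for the single affected slice, another
  \<open>\<epsilon>\<^sub>2\<close> for the number of preimages, and \<delta> for noisy ranks
  outside \<open>G\<close>.\<close>

lemma SliceQuantiles_insert_private:
  assumes X: "dataset b X" "x \<notin> X" and r: "r \<in> Good m (card X) (w + real_of_int h)"
    and gap: "\<And>i. i \<in> {2..m} \<Longrightarrow> 2 * (\<lceil>w\<rceil> + h) \<le> r i - r (i - 1)"
    and S: "S \<in> sets (PiM {1..m} (\<lambda>_. borel))"
  shows "measure (M r X) S \<le> exp (\<epsilon>\<^sub>1 + 2 * \<epsilon>\<^sub>2) * measure (M r (insert x X)) S + \<delta>"
    and "measure (M r (insert x X)) S \<le> exp (\<epsilon>\<^sub>1 + 2 * \<epsilon>\<^sub>2) * measure (M r X) S + \<delta>"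
proof -
  have \<epsilon>2': "0 \<le> \<epsilon>\<^sub>2" using \<epsilon>2 by simp
  have fin: "finite X" using X(1) by (simp add: dataset_def)
  have card: "card (insert x X) = card X + 1" using fin X(2) by simp
  have rv: "r \<in> int_vecs m" by (rule Good_input_mem[OF r])
  have b1: "1 \<le> b" by (rule one_le_of_dataset[OF X(1) Good_input_card[OF r]])
  have hpos: "0 < h" by (rule multiplicity_le_exp(1)[OF b1])
  define G where "G = close_vecs w r"
  define f where "f = (\<lambda>Y s. measure (conditional_output m b \<epsilon>\<^sub>2 h Y s) S)"
  have M: "measure (M r Y) S = measure_pmf.expectation (CC r) (f Y)" for Y
    unfolding f_def by (rule measure_SliceQuantiles[OF \<epsilon>2' b h S])
  have f: "0 \<le> f Y s" "f Y s \<le> 1" for Y s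
    unfolding f_def using prob_space.prob_le_1[OF prob_space_conditional_output[OF \<epsilon>2' b]] by auto
  have G: "finite G" unfolding G_def by (rule finite_close_vecs)
  have bad: "measure_pmf.prob (CC r) (- G) \<le> \<delta>" unfolding G_def by (rule prob_not_close_vecs_w[OF rv])
  have inside: "well_inside m (card X) h s" if "s \<in> G" for s
    using close_vecs_well_inside[OF r gap] that unfolding G_def by blast
  have Gsep: "s \<in> int_vecs m" "separated m (2 * h + 2) s" if "s \<in> G" for s
    using inside[OF that] by (auto simp: well_inside_def)
  have p: "pmf (CC r) s \<le> exp \<epsilon>\<^sub>1 * pmf (CC r) (threshold_shift m \<theta> c s)"
    if "s \<in> G" "c \<in> {-1, 1}" for s \<theta> c
    using h_nonneg by (intro pmf_CC_threshold_shift[OF rv Gsep(1,2)[OF that(1)] _ that(2)]) auto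
  have shifted: "threshold_shift m \<theta> c s \<in> Good m n (real_of_int h)"
    if "s \<in> G" "c \<in> {-1, 1}" "card X \<le> n" for s \<theta> c n
    using that(2) by (intro well_inside_threshold_shift_Good[OF m1 inside[OF that(1)] _ that(3) h_nonneg]) auto
  have unshifted: "s \<in> Good m n (real_of_int h)" if "s \<in> G" "card X \<le> n" for s n
    by (rule well_inside_Good[OF m1 inside[OF that(1)] that(2) h_nonneg])
  have step: "pmf (CC r) s * f Y s \<le>
      exp (\<epsilon>\<^sub>1 + \<epsilon>\<^sub>2) * (pmf (CC r) (threshold_shift m \<theta> c s) * f Y' (threshold_shift m \<theta> c s))"
    if "s \<in> G" "c \<in> {-1, 1}" "f Y s \<le> exp \<epsilon>\<^sub>2 * f Y' (threshold_shift m \<theta> c s)" for s \<theta> c Y Y'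
  proof -
    have "pmf (CC r) s * f Y s \<le> (exp \<epsilon>\<^sub>1 * pmf (CC r) (threshold_shift m \<theta> c s)) *
        (exp \<epsilon>\<^sub>2 * f Y' (threshold_shift m \<theta> c s))"
      using p[OF that(1,2)] that(3) f by (intro mult_mono) auto
    then show ?thesis by (simp add: exp_add mult_ac)
  qed
  have fin_bound: "exp (\<epsilon>\<^sub>1 + \<epsilon>\<^sub>2) * N * e + measure_pmf.prob (CC r) (- G) \<le> exp (\<epsilon>\<^sub>1 + 2 * \<epsilon>\<^sub>2) * e + \<delta>"
    if "N \<le> exp \<epsilon>\<^sub>2" "0 \<le> e" for N e
  proof -
    have "exp (\<epsilon>\<^sub>1 + \<epsilon>\<^sub>2) * N * e \<le> exp (\<epsilon>\<^sub>1 + \<epsilon>\<^sub>2) * exp \<epsilon>\<^sub>2 * e"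
      using that by (intro mult_right_mono mult_left_mono) auto
    also have "\<dots> = exp (\<epsilon>\<^sub>1 + 2 * \<epsilon>\<^sub>2) * e" by (simp flip: exp_add)
    finally show ?thesis using bad by linarith
  qed
  let ?\<rho> = "rank_in X x"
  show "measure (M r X) S \<le> exp (\<epsilon>\<^sub>1 + 2 * \<epsilon>\<^sub>2) * measure (M r (insert x X)) S + \<delta>"
  proof -
    \<comment> \<open>The upward shift is injective, so the single threshold
      \<open>?\<rho> + 1\<close> suffices with multiplicity \<open>1\<close>.\<close>
    have "measure_pmf.expectation (CC r) (f X) \<le>
      exp (\<epsilon>\<^sub>1 + \<epsilon>\<^sub>2) * 1 * measure_pmf.expectation (CC r) (f (insert x X)) + measure_pmf.prob (CC r) (- G)"
    proof (rule expectation_le_of_average_transport[where T="{?\<rho> + 1}" and F="\<lambda>\<theta>. threshold_shift m \<theta> 1"])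
      fix \<theta> s assume \<theta>: "\<theta> \<in> {?\<rho> + 1}" and s: "s \<in> G"
      have "f X s \<le> exp \<epsilon>\<^sub>2 * f (insert x X) (threshold_shift m \<theta> 1 s)"
        unfolding f_def using \<theta> h_nonneg unshifted[OF s, of "card X"] shifted[OF s, of 1 "card (insert x X)" \<theta>]
          measure_slice_medians_insert_ratio(1)[OF fin X(2) m1 \<epsilon>2' b h_nonneg inside[OF s] S, of \<theta>]
        by (simp add: conditional_output_Good card)
      then show "pmf (CC r) s * f X s \<le> exp (\<epsilon>\<^sub>1 + \<epsilon>\<^sub>2) *
          (pmf (CC r) (threshold_shift m \<theta> 1 s) * f (insert x X) (threshold_shift m \<theta> 1 s))"
        using step[OF s, of 1] by simp
    next
      fix u
      have "card {s \<in> G. threshold_shift m (?\<rho> + 1) 1 s = u} \<le> 1"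
        using G Gsep(1) inj_on_threshold_shift_up[of m "?\<rho> + 1"]
        by (subst One_nat_def, subst card_le_Suc0_iff_eq) (auto dest: inj_onD)
      then show "(\<Sum>\<theta>\<in>{?\<rho> + 1}. real (card {s \<in> G. threshold_shift m \<theta> 1 s = u})) \<le> 1 * real (card {?\<rho> + 1})"
        by simp
    qed (use G f in auto)
    also have "\<dots> \<le> exp (\<epsilon>\<^sub>1 + 2 * \<epsilon>\<^sub>2) * measure_pmf.expectation (CC r) (f (insert x X)) + \<delta>"
      using \<epsilon>2 f by (intro fin_bound) (auto intro: Bochner_Integration.integral_nonneg)
    finally show ?thesis unfolding M .
  qed
  show "measure (M r (insert x X)) S \<le> exp (\<epsilon>\<^sub>1 + 2 * \<epsilon>\<^sub>2) * measure (M r X) S + \<delta>"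
  proof -
    \<comment> \<open>This is the window of \<open>2 * h\<close> thresholds for a deletion, written
      in the form \<open>{a + 1..a + 2 * h}\<close>.\<close>
    let ?T = "{?\<rho> - h + 1 + 1..?\<rho> - h + 1 + 2 * h}"
    have "measure_pmf.expectation (CC r) (f (insert x X)) \<le>
      exp (\<epsilon>\<^sub>1 + \<epsilon>\<^sub>2) * (1 + 1 / (2 * real_of_int h)) * measure_pmf.expectation (CC r) (f X) +
      measure_pmf.prob (CC r) (- G)"
    proof (rule expectation_le_of_average_transport[where T="?T" and F="\<lambda>\<theta>. threshold_shift m \<theta> (-1)"])
      fix \<theta> s assume \<theta>: "\<theta> \<in> ?T" and s: "s \<in> G"
      have "f (insert x X) s \<le> exp \<epsilon>\<^sub>2 * f X (threshold_shift m \<theta> (-1) s)"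
        unfolding f_def using \<theta> h_nonneg unshifted[OF s, of "card (insert x X)"] shifted[OF s, of "-1" "card X" \<theta>]
          measure_slice_medians_insert_ratio(2)[OF fin X(2) m1 \<epsilon>2' b h_nonneg inside[OF s] S, of \<theta>]
        by (simp add: conditional_output_Good card)
      then show "pmf (CC r) s * f (insert x X) s \<le> exp (\<epsilon>\<^sub>1 + \<epsilon>\<^sub>2) *
          (pmf (CC r) (threshold_shift m \<theta> (-1) s) * f X (threshold_shift m \<theta> (-1) s))"
        using step[OF s, of "-1"] by simp
    next
      fix u assume "u \<in> (\<Union>\<theta>\<in>?T. threshold_shift m \<theta> (-1) ` G)"
      \<comment> \<open>Membership in \<open>Good\<close> separates the entries of the target by
        \<open>2 * h + 1\<close>, which limits its preimages on average.\<close>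
      then have "u \<in> Good m (card X) (real_of_int h)" using shifted by auto
      then have "separated m (2 * h + 1) u"
        using h_nonneg by (intro separated_of_consecutive) (auto simp: mem_Good_iff)
      moreover have "s \<in> int_vecs m \<and> separated m 2 s" if "s \<in> G" for s
        using Gsep[OF that] h_nonneg by (force simp: separated_def)
      ultimately show "(\<Sum>\<theta>\<in>?T. real (card {s \<in> G. threshold_shift m \<theta> (-1) s = u})) \<le>
          (1 + 1 / (2 * real_of_int h)) * real (card ?T)"
        using hpos by (intro sum_card_threshold_shift_down[where h=h]) auto
    qed (use G f hpos in auto)
    also have "\<dots> \<le> exp (\<epsilon>\<^sub>1 + 2 * \<epsilon>\<^sub>2) * measure_pmf.expectation (CC r) (f X) + \<delta>"
      using multiplicity_le_exp(2)[OF b1] f by (intro fin_bound) (auto intro: Bochner_Integration.integral_nonneg)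
    finally show ?thesis unfolding M .
  qed
qed

lemma SliceQuantiles_differentially_private:
  assumes gap: "\<And>i. i \<in> {2..m} \<Longrightarrow> 2 * (\<lceil>w\<rceil> + h) \<le> r i - r (i - 1)"
  shows "differentially_private {X. dataset b X \<and> r \<in> Good m (card X) (w + real_of_int h)}
    add_remove_adjacent (M r) (\<epsilon>\<^sub>1 + 2 * \<epsilon>\<^sub>2) \<delta>"
  unfolding differentially_private_def
proof (intro ballI impI, unfold mem_Collect_eq)
  fix X X' S
  assume X: "dataset b X \<and> r \<in> Good m (card X) (w + real_of_int h)"
    and X': "dataset b X' \<and> r \<in> Good m (card X') (w + real_of_int h)"
    and adj: "add_remove_adjacent X X'" and "S \<in> sets (M r X)"
  then have S: "S \<in> sets (PiM {1..m} (\<lambda>_. borel))"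
    using sets_SliceQuantiles[OF _ b h, of \<epsilon>\<^sub>2] \<epsilon>2 by simp
  \<comment> \<open>Adjacency allows \<open>x\<close> to be in the dataset already; then both
    datasets coincide.\<close>
  have refl: "measure (M r X) S \<le> exp (\<epsilon>\<^sub>1 + 2 * \<epsilon>\<^sub>2) * measure (M r X) S + \<delta>"
    using mult_right_mono[of 1 "exp (\<epsilon>\<^sub>1 + 2 * \<epsilon>\<^sub>2)" "measure (M r X) S"] \<epsilon>1 \<epsilon>2 \<delta> by simp
  from adj obtain x where "X' = insert x X \<or> X = insert x X'"
    by (auto simp: add_remove_adjacent_def)
  then consider "X' = X" | "x \<notin> X" "X' = insert x X" | "x \<notin> X'" "X = insert x X'"
    by (metis insert_absorb)
  then show "measure (M r X) S \<le> exp (\<epsilon>\<^sub>1 + 2 * \<epsilon>\<^sub>2) * measure (M r X') S + \<delta>"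
  proof cases
    case 1
    then show ?thesis using refl by simp
  next
    case 2
    then show ?thesis using SliceQuantiles_insert_private(1)[of X x r S] X gap S by simp
  next
    case 3
    then show ?thesis using SliceQuantiles_insert_private(2)[of X' x r S] X' gap S by simp
  qed
qed

end

section \<open>Accuracy\<close>

text \<open>Between positions \<open>k - 1\<close> and \<open>k\<close> lies an interval of length
  at least \<open>1\<close> on which the weight is \<open>1\<close>, so the normalizer is at least
  \<open>1\<close>. A rank further than \<open>h\<close> from \<open>k\<close> is clamped to an end
  of the slice, at distance at least \<open>h\<close> from its median; integrating that weight over
  \<open>[0, b]\<close> gives the bound.\<close>

lemma measure_exp_median_slice_tail:
  assumes X: "dataset b X" and h: "1 \<le> h" and k: "1 \<le> k - h" "k + h \<le> int (card X)"
    and \<epsilon>: "0 \<le> \<epsilon>" and b: "0 < b"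
  shows "measure (exp_median b \<epsilon> (slice X h k)) {z. h < \<bar>rank_in X z - k\<bar>} \<le> b * exp (- (\<epsilon> / 2) * real_of_int h)"
proof -
  define S where "S = slice X h k"
  let ?A = "{z. h < \<bar>rank_in X z - k\<bar>}" and ?W = "exp_median_weight \<epsilon> S"
  let ?Z = "LINT y:{0..b}|lborel. ?W y"
  have fin: "finite X" "finite S" using X by (auto simp: dataset_def S_def)
  have rank: "rank_in S z = max 0 (min (2 * h + 1) (rank_in X z - (k - h - 1)))" for z
    unfolding S_def using h k by (intro rank_in_slice[OF fin(1)]) auto
  have "real (card S) = 2 * real_of_int h + 1"
    unfolding S_def card_slice[OF fin(1) k] using h by simp
  then have half: "\<lfloor>real (card S) / 2\<rfloor> = h" by (simp add: floor_eq_iff)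
  have W: "?W z = exp (- (\<epsilon> / 2) * real_of_int \<bar>rank_in S z - h\<bar>)" for z
    by (simp add: exp_median_weight_def half)
  have A: "?A \<in> sets borel"
  proof -
    note [measurable] = measurable_rank_in[OF fin(1)]
    have "?A = {z \<in> space borel. real_of_int h < \<bar>real_of_int (rank_in X z) - real_of_int k\<bar>}"
      by (simp flip: of_int_diff of_int_abs)
    also have "\<dots> \<in> sets borel" by measurable
    finally show ?thesis .
  qed
  have tail: "?W z \<le> exp (- (\<epsilon> / 2) * real_of_int h)" if "z \<in> ?A" for z
  proof -
    have "h \<le> \<bar>rank_in S z - h\<bar>" using that h unfolding rank mem_Collect_eq by linarith
    then have "real_of_int h \<le> real_of_int \<bar>rank_in S z - h\<bar>" by (simp only: of_int_le_iff)
    from mult_left_mono[OF this, of "\<epsilon> / 2"] show ?thesis unfolding W using \<epsilon> by simp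
  qed
  \<comment> \<open>Since ranks count points strictly below, all of \<open>{a<..a'}\<close> has rank
    \<open>k - 1\<close> in \<open>X\<close>, which is the target rank \<open>h\<close> in the
    slice.\<close>
  define a a' where "a = order_stat X (k - 1)" and "a' = order_stat X k"
  have "a \<in> order_stat X ` {1..int (card X)}" "a' \<in> order_stat X ` {1..int (card X)}"
    unfolding a_def a'_def using h k by (auto intro!: imageI)
  then have ai: "a \<in> X" "a' \<in> X" unfolding order_stat_image[OF fin(1)] .
  have "a < a'" unfolding a_def a'_def using h k by (intro order_stat_strict_mono fin) auto
  moreover have "a \<in> {0..b}" "a' \<in> {0..b}" using ai X unfolding dataset_def by blast+
  moreover have "a \<noteq> a' \<longrightarrow> 1 \<le> \<bar>a - a'\<bar>" using ai X unfolding dataset_def by blast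
  ultimately have aa: "0 \<le> a" "a' \<le> b" "a + 1 \<le> a'" by auto
  have W1: "?W z = 1" if "z \<in> {a<..a'}" for z
  proof -
    have "k - 1 \<le> rank_in X z"
      using order_stat_less_iff[OF fin(1), of "k - 1" z] that h k by (auto simp: a_def)
    moreover have "\<not> k \<le> rank_in X z"
      using order_stat_less_iff[OF fin(1), of k z] that h k by (auto simp: a'_def)
    ultimately have "rank_in X z = k - 1" by simp
    then show ?thesis using h by (simp add: W rank)
  qed
  have "1 \<le> a' - a" using aa by simp
  also have "\<dots> = (LINT y|lborel. indicator {a<..a'} y)" using aa by simp
  also have "\<dots> \<le> ?Z"
    unfolding set_lebesgue_integral_def
  proof (rule integral_mono)
    show "integrable lborel (\<lambda>x. indicator {0..b} x *\<^sub>R ?W x)"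
      using integrable_exp_median_weight[OF fin(2) \<epsilon>, of b] by (simp add: set_integrable_def)
    show "indicator {a<..a'} x \<le> indicator {0..b} x *\<^sub>R ?W x" for x
      using W1[of x] exp_median_weight_pos[of \<epsilon> S x] aa by (auto simp: indicator_def)
  qed (use aa in \<open>auto intro!: integrable_real_indicator\<close>)
  finally have Z: "1 \<le> ?Z" .
  let ?c = "exp (- (\<epsilon> / 2) * real_of_int h)"
  have "emeasure (exp_median b \<epsilon> S) ?A \<le> (\<integral>\<^sup>+z. ennreal ?c * indicator {0..b} z \<partial>lborel)"
    unfolding emeasure_exp_median[OF fin(2) A]
  proof (rule nn_integral_mono)
    fix z
    have "?W z / ?Z \<le> ?c" if "z \<in> ?A"
      using Z tail[OF that] exp_median_weight_pos[of \<epsilon> S z] by (simp add: divide_le_eq mult_mono[of _ ?c 1 ?Z, simplified])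
    then show "ennreal (indicator {0..b} z * ?W z / ?Z) * indicator ?A z \<le> ennreal ?c * indicator {0..b} z"
      by (auto simp: indicator_def intro!: ennreal_leI)
  qed
  also have "\<dots> = ennreal (b * ?c)" using b
    by (subst nn_integral_cmult_indicator) (auto simp: ennreal_mult' mult.commute)
  finally have "emeasure (exp_median b \<epsilon> S) ?A \<le> ennreal (b * ?c)" .
  then show ?thesis
    unfolding S_def measure_def using b by (intro enn2real_leI) auto
qed

text \<open>Union bound over the coordinates, whose marginals are the factors.\<close>

lemma measure_PiM_component_union_le:
  assumes "finite I" "\<And>i. i \<in> I \<Longrightarrow> prob_space (M i)" "\<And>i. i \<in> I \<Longrightarrow> B i \<in> sets (M i)"
  shows "measure (PiM I M) {z \<in> space (PiM I M). \<exists>i\<in>I. z i \<in> B i} \<le> (\<Sum>i\<in>I. measure (M i) (B i))"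
proof -
  interpret P: prob_space "PiM I M" by (rule prob_space_PiM[OF assms(2)])
  let ?E = "\<lambda>i. {z \<in> space (PiM I M). z i \<in> B i}"
  have E: "?E i \<in> sets (PiM I M)" if "i \<in> I" for i
    using that assms(3)[OF that] by (intro sets_Collect_single) auto
  have "{z \<in> space (PiM I M). \<exists>i\<in>I. z i \<in> B i} = (\<Union>i\<in>I. ?E i)" by blast
  then have "measure (PiM I M) {z \<in> space (PiM I M). \<exists>i\<in>I. z i \<in> B i} \<le> (\<Sum>i\<in>I. measure (PiM I M) (?E i))"
    using P.finite_measure_subadditive_finite[OF assms(1), of ?E] E by auto
  also have "(\<Sum>i\<in>I. measure (PiM I M) (?E i)) = (\<Sum>i\<in>I. measure (M i) (B i))"
  proof (rule sum.cong[OF refl])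
    fix i assume i: "i \<in> I"
    have "measure (M i) (B i) = measure (distr (PiM I M) (M i) (\<lambda>z. z i)) (B i)"
      using distr_PiM_component[of I M i, OF assms(2) i] by simp
    also have "\<dots> = measure (PiM I M) (?E i)"
      using i assms(3)[OF i] by (subst measure_distr) (auto intro!: arg_cong[where f="measure (PiM I M)"])
    finally show "measure (PiM I M) (?E i) = measure (M i) (B i)" by simp
  qed
  finally show ?thesis .
qed

text \<open>The left side is the noise of \<open>CC\<close> at failure probability
  \<open>\<beta> / 2\<close> plus an upper bound for \<open>h\<close>. Additive constants are
  absorbed because \<open>ln m \<ge> 1/2\<close> and
  \<open>ln (m / \<beta>) \<ge> ln m\<close>.\<close>

lemma error_bound_numeric:
  fixes m :: nat
  assumes m: "2 \<le> m" and b: "1 \<le> b" and \<epsilon>: "0 < \<epsilon>\<^sub>1" "0 < \<epsilon>\<^sub>2" "\<epsilon> = \<epsilon>\<^sub>1 + 2 * \<epsilon>\<^sub>2" and \<beta>: "0 < \<beta>" "\<beta> < 1"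
    and K: "\<epsilon>\<^sub>1 \<le> K * \<epsilon>\<^sub>2" "\<epsilon>\<^sub>2 \<le> K * \<epsilon>\<^sub>1" "\<epsilon> \<le> K"
  shows "3 * ln (real m) * ln (2 * real m / (\<beta> / 2)) / \<epsilon>\<^sub>1 + (2 * ln (2 * b * real m / \<beta>) / \<epsilon>\<^sub>2 + 1)
    \<le> (25 + 30 * \<bar>K\<bar>) * (ln b / \<epsilon> + ln (real m) * ln (real m / \<beta>) / \<epsilon>)"
proof -
  define L P where "L = ln (real m)" and "P = ln (real m / \<beta>)"
  have K0: "0 < K" using K(3) \<epsilon> by linarith
  have e0: "0 < \<epsilon>" using \<epsilon> by simp
  have ln2: "1 / 2 \<le> ln (2::real)" "ln (2::real) \<le> 1"
    using ln_le_minus_one[of 2] ln2_ge_two_thirds by auto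
  have "ln 2 \<le> L" unfolding L_def using m by simp
  then have L: "1 / 2 \<le> L" "ln 2 \<le> L" using ln2 by linarith+
  have mb: "0 < real m / \<beta>" using m \<beta> by simp
  have "real m \<le> real m / \<beta>" using m \<beta> by (simp add: field_simps)
  then have P: "L \<le> P" unfolding L_def P_def using m by (intro ln_mono) auto
  have l0: "0 \<le> ln b" using b by simp
  have lnP: "ln (2 * (real m / \<beta>)) = ln 2 + P"
    unfolding P_def using mb by (intro ln_mult_pos) auto
  have "ln (2 * real m / (\<beta> / 2)) = ln (2 * (2 * (real m / \<beta>)))" by simp
  also have "\<dots> = ln 2 + ln (2 * (real m / \<beta>))" using mb by (intro ln_mult_pos) auto
  finally have l1: "ln (2 * real m / (\<beta> / 2)) \<le> 3 * P" using L P lnP by linarith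
  have "ln (2 * b * real m / \<beta>) = ln (b * (2 * (real m / \<beta>)))" by (simp add: mult_ac)
  also have "\<dots> = ln b + ln (2 * (real m / \<beta>))" using mb b by (intro ln_mult_pos) auto
  finally have l2: "ln (2 * b * real m / \<beta>) \<le> ln b + 2 * P" using L P lnP by linarith
  have LP: "P \<le> 2 * (L * P)" "1 \<le> 4 * (L * P)" "0 \<le> L * P"
    using mult_right_mono[of "1/2" L P] mult_mono[of "1/2" L "1/2" P] L P by auto
  \<comment> \<open>Comparability of the two parameters turns their reciprocals into multiples of
    \<open>1 / \<epsilon>\<close>; \<open>\<epsilon> \<le> K\<close> does the same for the
    \<open>1\<close> lost in rounding \<open>h\<close> up.\<close>
  have r1: "1 / \<epsilon>\<^sub>1 \<le> (1 + 2 * K) / \<epsilon>" using \<epsilon> K(2) e0 by (simp add: field_simps)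
  have r2: "1 / \<epsilon>\<^sub>2 \<le> (2 + K) / \<epsilon>" using \<epsilon> K(1) e0 by (simp add: field_simps)
  have r3: "1 \<le> K / \<epsilon>" using K(3) e0 by simp
  have "3 * L * ln (2 * real m / (\<beta> / 2)) / \<epsilon>\<^sub>1 \<le> 3 * L * (3 * P) * (1 / \<epsilon>\<^sub>1)"
    using l1 L \<epsilon> by (simp add: divide_right_mono)
  also have "\<dots> \<le> 9 * (L * P) * ((1 + 2 * K) / \<epsilon>)"
    using mult_left_mono[OF r1, of "9 * (L * P)"] LP by simp
  finally have t1: "3 * L * ln (2 * real m / (\<beta> / 2)) / \<epsilon>\<^sub>1 \<le> 9 * (L * P) * ((1 + 2 * K) / \<epsilon>)" .
  have "2 * ln (2 * b * real m / \<beta>) / \<epsilon>\<^sub>2 \<le> (2 * ln b + 8 * (L * P)) * (1 / \<epsilon>\<^sub>2)"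
    using l2 LP \<epsilon> by (simp add: divide_right_mono)
  also have "\<dots> \<le> (2 * ln b + 8 * (L * P)) * ((2 + K) / \<epsilon>)"
    using mult_left_mono[OF r2, of "2 * ln b + 8 * (L * P)"] LP l0 by simp
  finally have t2: "2 * ln (2 * b * real m / \<beta>) / \<epsilon>\<^sub>2 \<le> (2 * ln b + 8 * (L * P)) * ((2 + K) / \<epsilon>)" .
  have "1 * 1 \<le> (4 * (L * P)) * (K / \<epsilon>)" using LP r3 by (intro mult_mono) auto
  then have t3: "1 \<le> 4 * (L * P) * (K / \<epsilon>)" by simp
  \<comment> \<open>The coefficient of \<open>L * P\<close> collects \<open>9 * (1 + 2 * K)\<close>,
    \<open>8 * (2 + K)\<close> and \<open>4 * K\<close>.\<close>
  have "3 * L * ln (2 * real m / (\<beta> / 2)) / \<epsilon>\<^sub>1 + (2 * ln (2 * b * real m / \<beta>) / \<epsilon>\<^sub>2 + 1) \<le>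
      ((25 + 30 * K) * (L * P) + (4 + 2 * K) * ln b) / \<epsilon>"
  proof (rule order_trans[OF add_mono[OF t1 add_mono[OF t2 t3]]])
    show "9 * (L * P) * ((1 + 2 * K) / \<epsilon>) +
        ((2 * ln b + 8 * (L * P)) * ((2 + K) / \<epsilon>) + 4 * (L * P) * (K / \<epsilon>)) \<le>
      ((25 + 30 * K) * (L * P) + (4 + 2 * K) * ln b) / \<epsilon>"
      using e0 by (simp add: divide_simps) (simp add: algebra_simps)
  qed
  also have "\<dots> \<le> ((25 + 30 * K) * (L * P) + (25 + 30 * K) * ln b) / \<epsilon>"
    using K0 l0 e0 by (intro divide_right_mono add_left_mono mult_right_mono) auto
  also have "\<dots> = (25 + 30 * \<bar>K\<bar>) * (ln b / \<epsilon> + L * P / \<epsilon>)"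
    using K0 e0 by (simp add: field_simps)
  finally show ?thesis by (simp only: L_def P_def)
qed

section \<open>Failure probabilities of the mechanism\<close>

context slice_quantiles_parameters
begin

text \<open>The choice of \<open>h\<close> makes each tail at most \<open>\<beta> / (2 * m)\<close>,
  and there are \<open>m\<close> slices.\<close>

lemma measure_slice_medians_bad:
  assumes X: "dataset b X" and b1: "1 \<le> b" and s: "s \<in> Good m (card X) (real_of_int h)"
  shows "measure (slice_medians m b \<epsilon>\<^sub>2 h X s)
    {z \<in> space (slice_medians m b \<epsilon>\<^sub>2 h X s). \<exists>i\<in>{1..m}. z i \<in> {y. h < \<bar>rank_in X y - s i\<bar>}} \<le> \<beta> / 2"
proof -
  have "2 * ln (2 * b * real m / \<beta>) / \<epsilon>\<^sub>2 \<le> real_of_int h" unfolding h_eq by (rule le_of_int_ceiling)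
  then have "ln (2 * b * real m / \<beta>) \<le> (\<epsilon>\<^sub>2 / 2) * real_of_int h" using \<epsilon>2 by (simp add: field_simps)
  then have "exp (- (\<epsilon>\<^sub>2 / 2) * real_of_int h) \<le> exp (- ln (2 * b * real m / \<beta>))" by simp
  also have "\<dots> = \<beta> / (2 * b * real m)" using b m1 \<beta> by (simp add: exp_minus)
  finally have e: "b * exp (- (\<epsilon>\<^sub>2 / 2) * real_of_int h) \<le> \<beta> / (2 * real m)"
    using b m1 by (simp add: field_simps)
  have fin: "finite X" using X by (simp add: dataset_def)
  have "{y. h < \<bar>rank_in X y - k\<bar>} \<in> sets borel" for k
  proof -
    note [measurable] = measurable_rank_in[OF fin]
    have "{y. h < \<bar>rank_in X y - k\<bar>} = {y \<in> space borel. real_of_int h < \<bar>real_of_int (rank_in X y) - real_of_int k\<bar>}"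
      by (simp flip: of_int_diff of_int_abs)
    also have "\<dots> \<in> sets borel" by measurable
    finally show ?thesis .
  qed
  then have "measure (slice_medians m b \<epsilon>\<^sub>2 h X s)
      {z \<in> space (slice_medians m b \<epsilon>\<^sub>2 h X s). \<exists>i\<in>{1..m}. z i \<in> {y. h < \<bar>rank_in X y - s i\<bar>}}
      \<le> (\<Sum>i\<in>{1..m}. measure (exp_median b \<epsilon>\<^sub>2 (slice X h (s i))) {y. h < \<bar>rank_in X y - s i\<bar>})"
    using \<epsilon>2 b by (intro measure_PiM_component_union_le prob_space_exp_median) auto
  also have "\<dots> \<le> (\<Sum>i\<in>{1..m}. \<beta> / (2 * real m))"
  proof (rule sum_mono)
    fix i assume "i \<in> {1..m}"
    note bd = Good_bounds[OF s h_nonneg this]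
    have "1 \<le> h" using multiplicity_le_exp(1)[OF b1] by simp
    from measure_exp_median_slice_tail[OF X this bd _ b, of \<epsilon>\<^sub>2] e \<epsilon>2
    show "measure (exp_median b \<epsilon>\<^sub>2 (slice X h (s i))) {y. h < \<bar>rank_in X y - s i\<bar>} \<le> \<beta> / (2 * real m)"
      by linarith
  qed
  also have "\<dots> = \<beta> / 2" using m1 by simp
  finally show ?thesis .
qed

text \<open>An error exceeds the noise plus \<open>h\<close> only if the noise reaches
  \<open>w\<close> (probability \<delta>) or the threshold for \<open>\<beta> / 2\<close>, or if one
  of the medians fails (again \<open>\<beta> / 2\<close>).\<close>

lemma SliceQuantiles_accurate:
  assumes X: "dataset b X" and r: "r \<in> Good m (card X) (w + real_of_int h)"
    and c: "3 * ln (real m) * ln (2 * real m / (\<beta> / 2)) / \<epsilon>\<^sub>1 + real_of_int h \<le> c"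
  shows "1 - \<beta> - \<delta> \<le> measure (M r X)
    {z \<in> space (M r X). \<forall>i\<in>{1..m}. real_of_int \<bar>rank_in X (z i) - r i\<bar> \<le> c}"
proof -
  define N where "N = (PiM {1..m} (\<lambda>_. borel) :: (nat \<Rightarrow> real) measure)"
  define E where "E = {z \<in> space N. \<forall>i\<in>{1..m}. real_of_int \<bar>rank_in X (z i) - r i\<bar> \<le> c}"
  define \<tau> where "\<tau> = 3 * ln (real m) * ln (2 * real m / (\<beta> / 2)) / \<epsilon>\<^sub>1"
  have \<epsilon>2': "0 \<le> \<epsilon>\<^sub>2" using \<epsilon>2 by simp
  have fin: "finite X" using X by (simp add: dataset_def)
  have b1: "1 \<le> b" by (rule one_le_of_dataset[OF X Good_input_card[OF r]])
  have rv: "r \<in> int_vecs m" by (rule Good_input_mem[OF r])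
  have spM: "space (M r X) = space N"
    unfolding N_def by (rule sets_eq_imp_space_eq[OF sets_SliceQuantiles[OF \<epsilon>2' b h]])
  have E: "E \<in> sets N"
  proof -
    note [measurable] = measurable_rank_in[OF fin]
    show ?thesis unfolding E_def N_def of_int_abs of_int_diff by measurable
  qed
  \<comment> \<open>Closeness within \<open>w\<close> puts the noisy ranks in \<open>Good\<close>;
    closeness within \<tau> bounds the error.\<close>
  define H where "H = close_vecs w r \<inter> close_vecs \<tau> r"
  have "measure_pmf.prob (CC r) (- H) \<le>
      measure_pmf.prob (CC r) (- close_vecs w r) + measure_pmf.prob (CC r) (- close_vecs \<tau> r)"
    unfolding H_def Compl_Int by (intro measure_Un_le) auto
  also have "\<dots> \<le> \<delta> + \<beta> / 2"
    unfolding \<tau>_def using \<beta> by (intro add_mono prob_not_close_vecs_w prob_not_close_vecs rv) auto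
  finally have H: "measure_pmf.prob (CC r) (- H) \<le> \<delta> + \<beta> / 2" .
  \<comment> \<open>Off \<open>H\<close> the left side is negative, so the bound holds for every
    \<open>s\<close> and can be integrated.\<close>
  have key: "1 - \<beta> / 2 - indicator (- H) s \<le> measure (conditional_output m b \<epsilon>\<^sub>2 h X s) E" for s
  proof (cases "s \<in> H")
    case True
    then have s: "s \<in> close_vecs w r" "s \<in> close_vecs \<tau> r" by (auto simp: H_def)
    have good: "s \<in> Good m (card X) (real_of_int h)" by (rule close_vecs_Good[OF r s(1)])
    let ?P = "slice_medians m b \<epsilon>\<^sub>2 h X s"
    let ?B = "{z \<in> space ?P. \<exists>i\<in>{1..m}. z i \<in> {y. h < \<bar>rank_in X y - s i\<bar>}}"
    interpret P: prob_space ?P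
      using \<epsilon>2' b by (intro prob_space_PiM prob_space_exp_median) auto
    have sets: "sets ?P = sets N" unfolding N_def by (intro sets_PiM_cong) auto
    note sp = sets_eq_imp_space_eq[OF sets]
    have B: "?B \<in> sets ?P"
    proof -
      note [measurable] = measurable_rank_in[OF fin]
      have "{z \<in> space N. \<exists>i\<in>{1..m}. real_of_int h < \<bar>real_of_int (rank_in X (z i)) - real_of_int (s i)\<bar>} \<in> sets N"
        unfolding N_def by measurable
      then show ?thesis unfolding sets sp by (simp flip: of_int_diff of_int_abs)
    qed
    have "space ?P - ?B \<subseteq> E"
    proof
      fix z assume z: "z \<in> space ?P - ?B"
      have "real_of_int \<bar>rank_in X (z i) - r i\<bar> \<le> c" if i: "i \<in> {1..m}" for i
      proof -
        have "\<bar>rank_in X (z i) - s i\<bar> \<le> h" using z i by (auto simp: not_less)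
        then have "real_of_int \<bar>rank_in X (z i) - s i\<bar> \<le> real_of_int h" by (simp only: of_int_le_iff)
        moreover have "\<bar>real_of_int (r i) - real_of_int (s i)\<bar> < \<tau>" by (rule close_vecsD[OF s(2) i])
        ultimately show ?thesis using c unfolding \<tau>_def[symmetric] of_int_abs of_int_diff by linarith
      qed
      moreover have "z \<in> space N" using z sp by blast
      ultimately show "z \<in> E" by (auto simp: E_def)
    qed
    then have "measure ?P (space ?P - ?B) \<le> measure ?P E"
      using E sets by (intro P.finite_measure_mono) auto
    moreover have "measure ?P (space ?P - ?B) = 1 - measure ?P ?B" by (rule P.prob_compl[OF B])
    ultimately show ?thesis
      using measure_slice_medians_bad[OF X b1 good] True by (simp add: conditional_output_Good[OF good])
  next
    case False
    then show ?thesis using \<beta> by (simp add: order_trans[OF _ measure_nonneg])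
  qed
  have "1 - \<beta> - \<delta> \<le> 1 - \<beta> / 2 - measure_pmf.prob (CC r) (- H)" using H by simp
  also have "\<dots> = measure_pmf.expectation (CC r) (\<lambda>s. 1 - \<beta> / 2 - indicator (- H) s)"
    by (subst Bochner_Integration.integral_diff) (auto intro!: measure_pmf.integrable_const_bound[where B=1])
  also have "\<dots> \<le> measure_pmf.expectation (CC r) (\<lambda>s. measure (conditional_output m b \<epsilon>\<^sub>2 h X s) E)"
    using prob_space.prob_le_1[OF prob_space_conditional_output[OF \<epsilon>2' b]] \<beta>
    by (intro integral_mono key measure_pmf.integrable_const_bound[where B=1]) (auto simp: indicator_def)
  also have "\<dots> = measure (M r X) E"
    using E unfolding N_def by (intro measure_SliceQuantiles[OF \<epsilon>2' b h, symmetric])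
  finally show ?thesis unfolding spM E_def .
qed

end

text \<open>The constant of the asymptotic bound depends on \<open>K\<close> alone, where
  \<open>K\<close> bounds \<epsilon> and both ratios of \<open>\<epsilon>\<^sub>1\<close> and
  \<open>\<epsilon>\<^sub>2\<close>. Privacy is for a fixed rank vector \<open>r\<close>, shared by
  the adjacent datasets. The absolute value in the witness keeps it positive for every real
  \<open>K\<close>.\<close>

theorem corollary5p3:
  fixes K :: real
  shows "\<exists>C>0. \<forall>(m::nat) (b::real) (\<epsilon>\<^sub>1::real) (\<epsilon>\<^sub>2::real) (\<beta>::real) (\<delta>::real)
            (CC :: (nat \<Rightarrow> int) \<Rightarrow> (nat \<Rightarrow> int) pmf) (w::real) (len::int) (h::int) (\<epsilon>::real) M.
     1 \<le> m \<and> 0 < b \<and> 0 < \<epsilon>\<^sub>1 \<and> 0 < \<epsilon>\<^sub>2 \<and> \<beta> \<in> {0<..<1} \<and> \<delta> \<in> {0<..<1} \<and>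
     is_CC m \<epsilon>\<^sub>1 CC \<and>
     w = 3 * ln (real m) * ln (2 * real m / \<delta>) / \<epsilon>\<^sub>1 \<and>
     len = 2 * \<lceil>2 * ln (2 * b * real m / \<beta>) / \<epsilon>\<^sub>2\<rceil> + 1 \<and> 1 \<le> len \<and>
     h = slice_radius len \<and>
     \<epsilon> = \<epsilon>\<^sub>1 + 2 * \<epsilon>\<^sub>2 \<and>
     M = SliceQuantiles m b CC (exp_median b \<epsilon>\<^sub>2) len 0
     \<longrightarrow>
     (\<forall>r. (\<forall>i\<in>{2..m}. r i - r (i - 1) \<ge> 2 * (\<lceil>w\<rceil> + h)) \<longrightarrow>
          differentially_private
            {X. dataset b X \<and> r \<in> Good m (card X) (w + real_of_int h)}
            add_remove_adjacent (M r) \<epsilon> \<delta>)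
     \<and>
     (\<epsilon>\<^sub>1 \<le> K * \<epsilon>\<^sub>2 \<and> \<epsilon>\<^sub>2 \<le> K * \<epsilon>\<^sub>1 \<and> \<epsilon> \<le> K \<longrightarrow>
       (\<forall>X q. let n = card X; r = quantile_ranks m q n in
          dataset b X \<and> quantiles m q \<and>
          r \<in> Good m n (w + real_of_int h) \<and>
          quantile_gap_ge m q
            (6 * ln (real m) * ln (2 * real m / \<delta>) / (\<epsilon>\<^sub>1 * real n)
             + 4 * ln (2 * b * real m / \<beta>) / (\<epsilon>\<^sub>2 * real n))
          \<longrightarrow>
          1 - \<beta> - \<delta> \<le> measure (M r X)
            {z \<in> space (M r X). real_of_int (Err m X q z)
               \<le> C * (ln b / \<epsilon> + ln (real m) * ln (real m / \<beta>) / \<epsilon>)}))"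
proof (intro exI[of _ "25 + 30 * \<bar>K\<bar>"] conjI allI impI; (elim conjE)?)
  show "0 < 25 + 30 * \<bar>K\<bar>" by (simp add: add_pos_nonneg)
next
  fix m b \<epsilon>\<^sub>1 \<epsilon>\<^sub>2 \<beta> \<delta> CC w len h \<epsilon> M r
  assume "1 \<le> m" "0 < b" "0 < \<epsilon>\<^sub>1" "0 < \<epsilon>\<^sub>2" "\<beta> \<in> {0<..<1}" "\<delta> \<in> {0<..<1}" "is_CC m \<epsilon>\<^sub>1 CC"
    "w = 3 * ln (real m) * ln (2 * real m / \<delta>) / \<epsilon>\<^sub>1"
    "len = 2 * \<lceil>2 * ln (2 * b * real m / \<beta>) / \<epsilon>\<^sub>2\<rceil> + 1" "1 \<le> len" "h = slice_radius len"
  then interpret slice_quantiles_parameters m b \<epsilon>\<^sub>1 \<epsilon>\<^sub>2 \<beta> \<delta> w len h CC by unfold_locales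
  assume "\<forall>i\<in>{2..m}. r i - r (i - 1) \<ge> 2 * (\<lceil>w\<rceil> + h)" "\<epsilon> = \<epsilon>\<^sub>1 + 2 * \<epsilon>\<^sub>2"
    "M = SliceQuantiles m b CC (exp_median b \<epsilon>\<^sub>2) len 0"
  then show "differentially_private {X. dataset b X \<and> r \<in> Good m (card X) (w + real_of_int h)}
      add_remove_adjacent (M r) \<epsilon> \<delta>"
    using SliceQuantiles_differentially_private[of r] by simp
next
  fix m b \<epsilon>\<^sub>1 \<epsilon>\<^sub>2 \<beta> \<delta> CC w len h \<epsilon> M and X :: "real set" and q :: "nat \<Rightarrow> real"
  assume "1 \<le> m" "0 < b" and \<epsilon>: "0 < \<epsilon>\<^sub>1" "0 < \<epsilon>\<^sub>2" and \<beta>: "\<beta> \<in> {0<..<1}" and "\<delta> \<in> {0<..<1}" "is_CC m \<epsilon>\<^sub>1 CC"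
    "w = 3 * ln (real m) * ln (2 * real m / \<delta>) / \<epsilon>\<^sub>1"
    "len = 2 * \<lceil>2 * ln (2 * b * real m / \<beta>) / \<epsilon>\<^sub>2\<rceil> + 1" "1 \<le> len" "h = slice_radius len"
    and \<epsilon>_eq: "\<epsilon> = \<epsilon>\<^sub>1 + 2 * \<epsilon>\<^sub>2" and M_eq: "M = SliceQuantiles m b CC (exp_median b \<epsilon>\<^sub>2) len 0"
    and K: "\<epsilon>\<^sub>1 \<le> K * \<epsilon>\<^sub>2" "\<epsilon>\<^sub>2 \<le> K * \<epsilon>\<^sub>1" "\<epsilon> \<le> K"
  then interpret slice_quantiles_parameters m b \<epsilon>\<^sub>1 \<epsilon>\<^sub>2 \<beta> \<delta> w len h CC by unfold_locales
  define r where "r = quantile_ranks m q (card X)"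
  let ?c = "(25 + 30 * \<bar>K\<bar>) * (ln b / \<epsilon> + ln (real m) * ln (real m / \<beta>) / \<epsilon>)"
  have "1 - \<beta> - \<delta> \<le> measure (M r X) {z \<in> space (M r X). real_of_int (Err m X q z) \<le> ?c}"
    if X: "dataset b X" and r: "r \<in> Good m (card X) (w + real_of_int h)"
  proof -
    have "1 \<le> b" by (rule one_le_of_dataset[OF X Good_input_card[OF r]])
    from error_bound_numeric[OF m2 this \<epsilon> \<epsilon>_eq _ _ K] \<beta>
    have "3 * ln (real m) * ln (2 * real m / (\<beta> / 2)) / \<epsilon>\<^sub>1 + (2 * ln (2 * b * real m / \<beta>) / \<epsilon>\<^sub>2 + 1) \<le> ?c"
      by auto
    moreover have "real_of_int h \<le> 2 * ln (2 * b * real m / \<beta>) / \<epsilon>\<^sub>2 + 1"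
      unfolding h_eq by linarith
    ultimately have "3 * ln (real m) * ln (2 * real m / (\<beta> / 2)) / \<epsilon>\<^sub>1 + real_of_int h \<le> ?c"
      by linarith
    note acc = SliceQuantiles_accurate[OF X r this]
    have "real_of_int (Err m X q z) \<le> ?c \<longleftrightarrow> (\<forall>i\<in>{1..m}. real_of_int \<bar>rank_in X (z i) - r i\<bar> \<le> ?c)" for z
    proof -
      \<comment> \<open>The error is an integer, so comparing it with the floor allows the maximum
        to be unfolded over the integers.\<close>
      have "real_of_int (Err m X q z) \<le> ?c \<longleftrightarrow> Err m X q z \<le> \<lfloor>?c\<rfloor>" by (rule le_floor_iff[symmetric])
      also have "\<dots> \<longleftrightarrow> (\<forall>i\<in>{1..m}. \<bar>rank_in X (z i) - r i\<bar> \<le> \<lfloor>?c\<rfloor>)"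
        unfolding Err_def using m1 by (subst Max_le_iff) (auto simp: r_def quantile_ranks_def)
      also have "\<dots> \<longleftrightarrow> (\<forall>i\<in>{1..m}. real_of_int \<bar>rank_in X (z i) - r i\<bar> \<le> ?c)"
        by (simp only: le_floor_iff)
      finally show ?thesis .
    qed
    then show ?thesis using acc unfolding M_eq by simp
  qed
  then show "let n = card X; r = quantile_ranks m q n in
      dataset b X \<and> quantiles m q \<and> r \<in> Good m n (w + real_of_int h) \<and>
      quantile_gap_ge m q
        (6 * ln (real m) * ln (2 * real m / \<delta>) / (\<epsilon>\<^sub>1 * real n)
         + 4 * ln (2 * b * real m / \<beta>) / (\<epsilon>\<^sub>2 * real n)) \<longrightarrow>
      1 - \<beta> - \<delta> \<le> measure (M r X) {z \<in> space (M r X). real_of_int (Err m X q z) \<le> ?c}"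
    unfolding Let_def r_def by blast
qed

end
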